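(* Let $(M,\omega)$ be a four-dimensional symplectic manifold, let $\rho_1,\rho_2\colon M\to M$ be two distinct commuting antisymplectic involutions, and let $H\colon M\to\mathbb{R}$ be a smooth function with $H\circ\rho_1=H$ and $H\circ\rho_2=H$. Let $\mathcal{C}$ be a finite collection of doubly symmetric periodic orbits of $X_H$ (with respect to $\rho_1,\rho_2$) whose SFT-Euler characteristic $\chi_{SFT}(\mathcal{C})$ is negative. Then $\mathcal{C}$ contains a stable periodic orbit.
   Context: Conventions. A diffeomorphism $\rho$ of $M$ is an antisymplectic involution if $\rho^2=\mathrm{id}$ and $\rho^*\omega=-\omega$. The Hamiltonian vector field $X_H$ is defined by $dH=\omega(\cdot,X_H)$, and $\phi^t_H$ denotes its flow. Put $S^1=\mathbb{R}/\mathbb{Z}$. A simple periodic orbit is an injective map $v\colon S^1\to M$ for which there is $\tau>0$ (its period) with $\partial_t v(t)=\tau X_H(v(t))$ for all $t\in S^1$. Doubly symmetric orbits. A simple periodic orbit $v$ is symmetric with respect to $\rho_1$ if $\rho_1(v(-t))=v(t)$ for all $t\in S^1$. It is doubly symmetric (with respect to $\rho_1,\rho_2$) if it is symmetric with respect to $\rho_1$ and in addition $\rho_2(v(0))=v(\tfrac12)$. Reduced monodromy. Let $\Sigma=H^{-1}(H(v(0)))$, which is a hypersurface near $v$. The linear map $d\phi^\tau_H(v(0))$ preserves $T_{v(0)}\Sigma$ and fixes $X_H(v(0))$. The induced map $M_v$ on the two-dimensional symplectic vector space $T_{v(0)}\Sigma/\langle X_H(v(0))\rangle$ is the reduced monodromy;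 $\det M_v=1$. The orbit $v$ is positive hyperbolic if $\mathrm{tr}(M_v)>2$, negative hyperbolic if $\mathrm{tr}(M_v)<-2$, and elliptic if $-2\le\mathrm{tr}(M_v)\le 2$. In dimension four, the stable orbits are precisely the elliptic ones. A periodic orbit is bad if it is an even cover of a negative hyperbolic orbit, and good otherwise. The SFT-Euler characteristic of a collection of periodic orbits is $$\chi_{SFT}=\#\{\text{good positive hyperbolic}\}-\#\{\text{elliptic, negative hyperbolic}\},$$ where one counts the orbits of each type in the collection. *)

theory Defs
  imports "HOL-Analysis.Analysis"
begin

section \<open>Smooth manifolds\<close>

primrec Ck_on :: "nat \<Rightarrow> 'a::real_normed_vector set \<Rightarrow> ('a \<Rightarrow> 'b::real_normed_vector) \<Rightarrow> bool" where
  "Ck_on 0 S f \<longleftrightarrow> continuous_on S f"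
| "Ck_on (Suc k) S f \<longleftrightarrow> (\<exists>f'. (\<forall>x\<in>S. (f has_derivative f' x) (at x)) \<and> (\<forall>u. Ck_on k S (\<lambda>x. f' x u)))"

text \<open>Only used for open \<open>S\<close> in a finite-dimensional space, where asking for the continuity of all
  iterated directional derivatives is the usual notion of a \<open>C\<^sup>k\<close> map.\<close>

definition smooth_on :: "'a::real_normed_vector set \<Rightarrow> ('a \<Rightarrow> 'b::real_normed_vector) \<Rightarrow> bool" where
  "smooth_on S f \<longleftrightarrow> (\<forall>k. Ck_on k S f)"

text \<open>The manifold is the whole type \<open>'m\<close>, which in the final statement is Hausdorff and second
  countable. A chart is a domain together with a map that is only relevant on that domain.\<close>

type_synonym ('m, 'e) chart = "'m set \<times> ('m \<Rightarrow> 'e)"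
type_synonym ('m, 'e) atlas = "('m, 'e) chart set"

definition inv_chart :: "('m, 'e) chart \<Rightarrow> 'e \<Rightarrow> 'm" where
  "inv_chart c = inv_into (fst c) (snd c)"

definition topological_chart :: "('m::topological_space, 'e::euclidean_space) chart \<Rightarrow> bool" where
  "topological_chart c \<longleftrightarrow> open (fst c) \<and> open (snd c ` fst c) \<and>
     homeomorphism (fst c) (snd c ` fst c) (snd c) (inv_chart c)"

definition smooth_atlas :: "('m::topological_space, 'e::euclidean_space) atlas \<Rightarrow> bool" where
  "smooth_atlas A \<longleftrightarrow> (\<Union>c\<in>A. fst c) = UNIV \<and> (\<forall>c\<in>A. topological_chart c) \<and>
     (\<forall>c\<in>A. \<forall>d\<in>A. smooth_on (snd c ` (fst c \<inter> fst d)) (snd d \<circ> inv_chart c))"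

definition smooth_map :: "('m::topological_space, 'e::euclidean_space) atlas \<Rightarrow> ('m \<Rightarrow> 'm) \<Rightarrow> bool" where
  "smooth_map A f \<longleftrightarrow> continuous_on UNIV f \<and>
     (\<forall>c\<in>A. \<forall>d\<in>A. smooth_on (snd c ` (fst c \<inter> f -` fst d)) (snd d \<circ> f \<circ> inv_chart c))"

definition diffeomorphism :: "('m::topological_space, 'e::euclidean_space) atlas \<Rightarrow> ('m \<Rightarrow> 'm) \<Rightarrow> bool" where
  "diffeomorphism A f \<longleftrightarrow> bij f \<and> smooth_map A f \<and> smooth_map A (inv f)"

definition smooth_fun :: "('m::topological_space, 'e::euclidean_space) atlas \<Rightarrow> ('m \<Rightarrow> real) \<Rightarrow> bool" where
  "smooth_fun A h \<longleftrightarrow> (\<forall>c\<in>A. smooth_on (snd c ` fst c) (h \<circ> inv_chart c))"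

section \<open>Tangent vectors\<close>

text \<open>The tangent space at \<open>p\<close> is the model space \<open>'e\<close>: a vector stands for the tangent vector
  having these coordinates in the preferred chart \<open>chart_at A p\<close>. The choice of preferred charts
  need not depend continuously on \<open>p\<close>, so smoothness of a tensor field is always
  tested after passing to the coordinates of one fixed chart by means of \<open>tangent_of\<close>.\<close>

definition chart_at :: "('m, 'e) atlas \<Rightarrow> 'm \<Rightarrow> ('m, 'e) chart" where
  "chart_at A p = (SOME c. c \<in> A \<and> p \<in> fst c)"

text \<open>\<open>tangent_of A c x u\<close> is the tangent vector at the point \<open>inv_chart c x\<close> whose coordinates
  in the chart \<open>c\<close> are \<open>u\<close>.\<close>

definition tangent_of :: "('m, 'e::euclidean_space) atlas \<Rightarrow> ('m, 'e) chart \<Rightarrow> 'e \<Rightarrow> 'e \<Rightarrow> 'e" where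
  "tangent_of A c x = frechet_derivative (snd (chart_at A (inv_chart c x)) \<circ> inv_chart c) (at x)"

definition differential :: "('m, 'e::euclidean_space) atlas \<Rightarrow> ('m \<Rightarrow> 'm) \<Rightarrow> 'm \<Rightarrow> 'e \<Rightarrow> 'e" where
  "differential A f p =
     frechet_derivative (snd (chart_at A (f p)) \<circ> f \<circ> inv_chart (chart_at A p)) (at (snd (chart_at A p) p))"

definition dfun :: "('m, 'e::euclidean_space) atlas \<Rightarrow> ('m \<Rightarrow> real) \<Rightarrow> 'm \<Rightarrow> 'e \<Rightarrow> real" where
  "dfun A h p = frechet_derivative (h \<circ> inv_chart (chart_at A p)) (at (snd (chart_at A p) p))"

definition has_velocity ::
  "('m::topological_space, 'e::euclidean_space) atlas \<Rightarrow> (real \<Rightarrow> 'm) \<Rightarrow> real \<Rightarrow> 'e \<Rightarrow> bool" where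
  "has_velocity A \<gamma> t u \<longleftrightarrow> isCont \<gamma> t \<and>
     ((snd (chart_at A (\<gamma> t)) \<circ> \<gamma>) has_vector_derivative u) (at t)"

section \<open>Symplectic forms and Hamiltonian flows\<close>

definition coord_form ::
  "('m, 'e::euclidean_space) atlas \<Rightarrow> ('m \<Rightarrow> 'e \<Rightarrow> 'e \<Rightarrow> real) \<Rightarrow> ('m, 'e) chart \<Rightarrow> 'e \<Rightarrow> 'e \<Rightarrow> 'e \<Rightarrow> real" where
  "coord_form A \<omega> c x u w = \<omega> (inv_chart c x) (tangent_of A c x u) (tangent_of A c x w)"

definition two_form ::
  "('m::topological_space, 'e::euclidean_space) atlas \<Rightarrow> ('m \<Rightarrow> 'e \<Rightarrow> 'e \<Rightarrow> real) \<Rightarrow> bool" where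
  "two_form A \<omega> \<longleftrightarrow> (\<forall>p. bilinear (\<omega> p) \<and> (\<forall>u. \<omega> p u u = 0)) \<and>
     (\<forall>c\<in>A. \<forall>u w. smooth_on (snd c ` fst c) (\<lambda>x. coord_form A \<omega> c x u w))"

text \<open>The exterior derivative of \<open>\<omega>\<close> evaluated on the constant coordinate fields \<open>u\<close>, \<open>v\<close>, \<open>w\<close>;
  their Lie brackets vanish.\<close>

definition closed_form ::
  "('m::topological_space, 'e::euclidean_space) atlas \<Rightarrow> ('m \<Rightarrow> 'e \<Rightarrow> 'e \<Rightarrow> real) \<Rightarrow> bool" where
  "closed_form A \<omega> \<longleftrightarrow> (\<forall>c\<in>A. \<forall>x\<in>snd c ` fst c. \<forall>u v w.
     frechet_derivative (\<lambda>y. coord_form A \<omega> c y v w) (at x) u +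
     frechet_derivative (\<lambda>y. coord_form A \<omega> c y w u) (at x) v +
     frechet_derivative (\<lambda>y. coord_form A \<omega> c y u v) (at x) w = 0)"

definition symplectic_form ::
  "('m::topological_space, 'e::euclidean_space) atlas \<Rightarrow> ('m \<Rightarrow> 'e \<Rightarrow> 'e \<Rightarrow> real) \<Rightarrow> bool" where
  "symplectic_form A \<omega> \<longleftrightarrow> two_form A \<omega> \<and> closed_form A \<omega> \<and>
     (\<forall>p u. (\<forall>w. \<omega> p u w = 0) \<longrightarrow> u = 0)"

definition antisymplectic_involution ::
  "('m::topological_space, 'e::euclidean_space) atlas \<Rightarrow> ('m \<Rightarrow> 'e \<Rightarrow> 'e \<Rightarrow> real) \<Rightarrow> ('m \<Rightarrow> 'm) \<Rightarrow> bool" where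
  "antisymplectic_involution A \<omega> \<rho> \<longleftrightarrow> diffeomorphism A \<rho> \<and> \<rho> \<circ> \<rho> = id \<and>
     (\<forall>p u w. \<omega> (\<rho> p) (differential A \<rho> p u) (differential A \<rho> p w) = - \<omega> p u w)"

definition ham_field ::
  "('m, 'e::euclidean_space) atlas \<Rightarrow> ('m \<Rightarrow> 'e \<Rightarrow> 'e \<Rightarrow> real) \<Rightarrow> ('m \<Rightarrow> real) \<Rightarrow> 'm \<Rightarrow> 'e" where
  "ham_field A \<omega> H p = (THE X. \<forall>w. dfun A H p w = \<omega> p w X)"

text \<open>\<open>is_flow A X D \<phi>\<close>: the map \<open>\<phi>\<close> is the flow of the vector field \<open>X\<close>, with maximal flow
  domain \<open>D\<close>. The field \<open>X\<close> need not be complete. By the fundamental theorem on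
  flows a smooth \<open>X\<close> on a Hausdorff manifold has exactly one flow: \<open>D\<close> and the values of \<open>\<phi>\<close> on \<open>D\<close> are unique.\<close>

definition is_flow ::
  "('m::topological_space, 'e::euclidean_space) atlas \<Rightarrow> ('m \<Rightarrow> 'e) \<Rightarrow> (real \<times> 'm) set \<Rightarrow> (real \<Rightarrow> 'm \<Rightarrow> 'm) \<Rightarrow> bool" where
  "is_flow A X D \<phi> \<longleftrightarrow>
     open D \<and> (\<forall>p. is_interval {t. (t, p) \<in> D} \<and> (0, p) \<in> D) \<and>
     continuous_on D (\<lambda>(t, p). \<phi> t p) \<and>
     (\<forall>c\<in>A. \<forall>d\<in>A. smooth_on
        {(t, x). x \<in> snd c ` fst c \<and> (t, inv_chart c x) \<in> D \<and> \<phi> t (inv_chart c x) \<in> fst d}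
        (\<lambda>(t, x). snd d (\<phi> t (inv_chart c x)))) \<and>
     (\<forall>p. \<phi> 0 p = p) \<and>
     (\<forall>(t, p)\<in>D. has_velocity A (\<lambda>s. \<phi> s p) t (X (\<phi> t p))) \<and>
     (\<forall>\<gamma> J. open J \<and> is_interval J \<and> 0 \<in> J \<and> (\<forall>t\<in>J. has_velocity A \<gamma> t (X (\<gamma> t)))
        \<longrightarrow> (\<forall>t\<in>J. (t, \<gamma> 0) \<in> D))"

section \<open>Periodic orbits\<close>

text \<open>Maps on \<open>S\<^sup>1 = \<real>/\<int>\<close> are represented by \<open>1\<close>-periodic maps on \<open>\<real>\<close>. A periodic orbit in the
  following sense may be a multiple cover.\<close>

definition periodic_orbit ::
  "('m::topological_space, 'e::euclidean_space) atlas \<Rightarrow> ('m \<Rightarrow> 'e) \<Rightarrow> (real \<Rightarrow> 'm) \<Rightarrow> real \<Rightarrow> bool" where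
  "periodic_orbit A X v \<tau> \<longleftrightarrow> \<tau> > 0 \<and> (\<forall>t. v (t + 1) = v t) \<and>
     (\<forall>t. has_velocity A v t (\<tau> *\<^sub>R X (v t)))"

definition simple_periodic_orbit ::
  "('m::topological_space, 'e::euclidean_space) atlas \<Rightarrow> ('m \<Rightarrow> 'e) \<Rightarrow> (real \<Rightarrow> 'm) \<Rightarrow> bool" where
  "simple_periodic_orbit A X v \<longleftrightarrow> (\<exists>\<tau>. periodic_orbit A X v \<tau>) \<and> inj_on v {0..<1}"

definition symmetric_orbit ::
  "('m::topological_space, 'e::euclidean_space) atlas \<Rightarrow> ('m \<Rightarrow> 'e) \<Rightarrow> ('m \<Rightarrow> 'm) \<Rightarrow> (real \<Rightarrow> 'm) \<Rightarrow> bool" where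
  "symmetric_orbit A X \<rho> v \<longleftrightarrow> simple_periodic_orbit A X v \<and> (\<forall>t. \<rho> (v (- t)) = v t)"

definition doubly_symmetric_orbit ::
  "('m::topological_space, 'e::euclidean_space) atlas \<Rightarrow> ('m \<Rightarrow> 'e) \<Rightarrow> ('m \<Rightarrow> 'm) \<Rightarrow> ('m \<Rightarrow> 'm) \<Rightarrow> (real \<Rightarrow> 'm) \<Rightarrow> bool" where
  "doubly_symmetric_orbit A X \<rho>1 \<rho>2 v \<longleftrightarrow> symmetric_orbit A X \<rho>1 v \<and> \<rho>2 (v 0) = v (1/2)"

text \<open>\<open>a\<close> is the matrix, with respect to some basis of the quotient space \<open>V / L\<close>, of the
  endomorphism of \<open>V / L\<close> induced by \<open>F\<close>. The classes of the vectors \<open>b i\<close> form the basis.\<close>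

definition quotient_matrix ::
  "'e::real_vector set \<Rightarrow> 'e set \<Rightarrow> ('e \<Rightarrow> 'e) \<Rightarrow> real^'n^'n \<Rightarrow> bool" where
  "quotient_matrix V L F a \<longleftrightarrow> (\<exists>b. (\<forall>i. b i \<in> V) \<and>
     (\<forall>w\<in>V. \<exists>!k :: real^'n. w - (\<Sum>i\<in>UNIV. k $ i *\<^sub>R b i) \<in> L) \<and>
     (\<forall>j. F (b j) - (\<Sum>i\<in>UNIV. a $ i $ j *\<^sub>R b i) \<in> L))"

text \<open>The matrix of the reduced monodromy in some basis. The tangent space of
  the level set of \<open>H\<close> at the regular point \<open>v 0\<close> is the kernel of the differential of \<open>H\<close>.\<close>

definition reduced_monodromy ::
  "('m::topological_space, 'e::euclidean_space) atlas \<Rightarrow> ('m \<Rightarrow> 'e \<Rightarrow> 'e \<Rightarrow> real) \<Rightarrow> ('m \<Rightarrow> real) \<Rightarrow> (real \<Rightarrow> 'm) \<Rightarrow> real^2^2 \<Rightarrow> bool" where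
  "reduced_monodromy A \<omega> H v a \<longleftrightarrow> (\<exists>\<tau> D \<phi>.
     periodic_orbit A (ham_field A \<omega> H) v \<tau> \<and> is_flow A (ham_field A \<omega> H) D \<phi> \<and>
     quotient_matrix {w. dfun A H (v 0) w = 0} (span {ham_field A \<omega> H (v 0)})
       (differential A (\<phi> \<tau>) (v 0)) a)"

definition positive_hyperbolic ::
  "('m::topological_space, 'e::euclidean_space) atlas \<Rightarrow> ('m \<Rightarrow> 'e \<Rightarrow> 'e \<Rightarrow> real) \<Rightarrow> ('m \<Rightarrow> real) \<Rightarrow> (real \<Rightarrow> 'm) \<Rightarrow> bool" where
  "positive_hyperbolic A \<omega> H v \<longleftrightarrow> (\<exists>a. reduced_monodromy A \<omega> H v a \<and> trace a > 2)"

definition negative_hyperbolic ::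
  "('m::topological_space, 'e::euclidean_space) atlas \<Rightarrow> ('m \<Rightarrow> 'e \<Rightarrow> 'e \<Rightarrow> real) \<Rightarrow> ('m \<Rightarrow> real) \<Rightarrow> (real \<Rightarrow> 'm) \<Rightarrow> bool" where
  "negative_hyperbolic A \<omega> H v \<longleftrightarrow> (\<exists>a. reduced_monodromy A \<omega> H v a \<and> trace a < - 2)"

definition elliptic ::
  "('m::topological_space, 'e::euclidean_space) atlas \<Rightarrow> ('m \<Rightarrow> 'e \<Rightarrow> 'e \<Rightarrow> real) \<Rightarrow> ('m \<Rightarrow> real) \<Rightarrow> (real \<Rightarrow> 'm) \<Rightarrow> bool" where
  "elliptic A \<omega> H v \<longleftrightarrow> (\<exists>a. reduced_monodromy A \<omega> H v a \<and> - 2 \<le> trace a \<and> trace a \<le> 2)"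

text \<open>In dimension four stability of a periodic orbit means ellipticity.\<close>

abbreviation stable_orbit ::
  "('m::topological_space, 'e::euclidean_space) atlas \<Rightarrow> ('m \<Rightarrow> 'e \<Rightarrow> 'e \<Rightarrow> real) \<Rightarrow> ('m \<Rightarrow> real) \<Rightarrow> (real \<Rightarrow> 'm) \<Rightarrow> bool" where
  "stable_orbit \<equiv> elliptic"

definition bad_orbit ::
  "('m::topological_space, 'e::euclidean_space) atlas \<Rightarrow> ('m \<Rightarrow> 'e \<Rightarrow> 'e \<Rightarrow> real) \<Rightarrow> ('m \<Rightarrow> real) \<Rightarrow> (real \<Rightarrow> 'm) \<Rightarrow> bool" where
  "bad_orbit A \<omega> H v \<longleftrightarrow>
     (\<exists>w (k::nat). negative_hyperbolic A \<omega> H w \<and> k > 0 \<and> even k \<and> v = (\<lambda>t. w (real k * t)))"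

definition chi_SFT ::
  "('m::topological_space, 'e::euclidean_space) atlas \<Rightarrow> ('m \<Rightarrow> 'e \<Rightarrow> 'e \<Rightarrow> real) \<Rightarrow> ('m \<Rightarrow> real) \<Rightarrow> (real \<Rightarrow> 'm) set \<Rightarrow> int" where
  "chi_SFT A \<omega> H C =
     int (card {v \<in> C. positive_hyperbolic A \<omega> H v \<and> \<not> bad_orbit A \<omega> H v}) -
     int (card {v \<in> C. elliptic A \<omega> H v \<or> negative_hyperbolic A \<omega> H v})"

end

theory Submission
  imports Defs
begin

text \<open>
  A doubly symmetric orbit is never negative hyperbolic. Consequently, if no orbit of the collection
  were elliptic, nothing would be subtracted in the SFT-Euler characteristic, which would then be
  nonnegative.

  Let \<open>v\<close> be doubly symmetric of period \<open>\<tau>\<close>, \<open>p = v 0\<close>, and \<open>h = \<tau> / 2\<close>. An antisymplectic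
  involution \<open>\<rho>\<close> preserving \<open>H\<close> maps the Hamiltonian field to its negative
  (\<open>antisymplectic_involution_ham_field\<close>) and therefore reverses the flow:
  \<open>\<rho> \<circ> \<phi> t \<circ> \<rho> = \<phi> (- t)\<close> where this makes sense (\<open>antisymplectic_involution_reverses_flow\<close>).
  Put \<open>\<psi> = \<rho>2 \<circ> \<phi> h\<close>. Both \<open>\<rho>1\<close> and \<open>\<psi>\<close> fix \<open>p\<close>, the reversal by \<open>\<rho>2\<close> gives \<open>\<psi> \<circ> \<psi> = id\<close>
  near \<open>p\<close>, and as \<open>\<rho>1 \<circ> \<rho>2\<close> is an involution commuting with the flow,
  \<open>(\<rho>1 \<circ> \<psi>) \<circ> (\<rho>1 \<circ> \<psi>) = \<phi> \<tau>\<close> near \<open>p\<close>. So the differential of \<open>\<phi> \<tau>\<close> at \<open>p\<close> is the square of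
  \<open>R \<circ> S\<close>, where \<open>R\<close> and \<open>S\<close> are the differentials of \<open>\<rho>1\<close> and \<open>\<psi>\<close>. These are linear involutions
  that preserve the kernel of \<open>dH\<close> and change the sign of the Hamiltonian field, and hence act on the
  two-dimensional quotient. There \<open>det (R \<circ> S)\<close> is \<open>1\<close> or \<open>- 1\<close>, so the trace of the reduced
  monodromy, \<open>(trace (R \<circ> S))\<^sup>2 - 2 * det (R \<circ> S)\<close>, is at least \<open>- 2\<close>
  (\<open>trace_square_involutions_ge\<close>, \<open>trace_doubly_symmetric_ge\<close>).

  The analytic ingredient is the uniqueness of integral curves (\<open>integral_curve_unique\<close>). In a chart
  the field is the time derivative of the smooth flow at time \<open>0\<close>, hence locally Lipschitz
  (\<open>flow_field_in_chart\<close>, \<open>C1_locally_lipschitz\<close>).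
\<close>

section \<open>Linear algebra of the quotient\<close>

text \<open>\<open>m\<close> is the matrix of the endomorphism that \<open>G\<close> induces on a quotient by \<open>L\<close>, with respect
  to the classes of the vectors \<open>b i\<close>. Unlike \<open>quotient_matrix\<close>, which hides the basis, this allows
  several endomorphisms to be compared in one basis.\<close>

definition quotient_rep :: "'e::real_vector set \<Rightarrow> ('n::finite \<Rightarrow> 'e) \<Rightarrow> ('e \<Rightarrow> 'e) \<Rightarrow> real^'n^'n \<Rightarrow> bool" where
  "quotient_rep L b G m \<longleftrightarrow> (\<forall>j. G (b j) - (\<Sum>i\<in>UNIV. m $ i $ j *\<^sub>R b i) \<in> L)"

lemma quotient_rep_exists:
  fixes b :: "'n::finite \<Rightarrow> 'e::real_vector"
  assumes "\<And>w. w \<in> V \<Longrightarrow> \<exists>!k :: real^'n. w - (\<Sum>i\<in>UNIV. k $ i *\<^sub>R b i) \<in> L"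
    and "\<And>i. b i \<in> V" and "\<And>w. w \<in> V \<Longrightarrow> G w \<in> V"
  shows "\<exists>m. quotient_rep L b G m"
proof -
  have "\<forall>j. \<exists>k :: real^'n. G (b j) - (\<Sum>i\<in>UNIV. k $ i *\<^sub>R b i) \<in> L"
    using assms by blast
  then obtain k :: "'n \<Rightarrow> real^'n" where "\<forall>j. G (b j) - (\<Sum>i\<in>UNIV. k j $ i *\<^sub>R b i) \<in> L"
    by metis
  then have "quotient_rep L b G (\<chi> i j. k j $ i)"
    by (simp add: quotient_rep_def)
  then show ?thesis ..
qed

lemma quotient_rep_unique:
  fixes b :: "'n::finite \<Rightarrow> 'e::real_vector"
  assumes basis: "\<exists>!k :: real^'n. 0 - (\<Sum>i\<in>UNIV. k $ i *\<^sub>R b i) \<in> L"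
    and L: "subspace L" and m: "quotient_rep L b G m" and m': "quotient_rep L b G m'"
  shows "m = m'"
proof -
  have "m $ i $ j = m' $ i $ j" for i j
  proof -
    let ?k = "(\<chi> i. m $ i $ j - m' $ i $ j) :: real^'n"
    have "(G (b j) - (\<Sum>i\<in>UNIV. m $ i $ j *\<^sub>R b i)) - (G (b j) - (\<Sum>i\<in>UNIV. m' $ i $ j *\<^sub>R b i)) \<in> L"
      using m m' unfolding quotient_rep_def by (blast intro: subspace_diff[OF L])
    then have "0 - (\<Sum>i\<in>UNIV. ?k $ i *\<^sub>R b i) \<in> L"
      by (simp add: scaleR_diff_left sum_subtractf)
    moreover have "0 - (\<Sum>i\<in>UNIV. (0 :: real^'n) $ i *\<^sub>R b i) \<in> L"
      using subspace_0[OF L] by simp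
    ultimately have "?k = 0"
      using basis by blast
    then show ?thesis
      by (metis (no_types, lifting) eq_iff_diff_eq_0 vec_lambda_beta zero_index)
  qed
  then show ?thesis
    by (simp add: vec_eq_iff)
qed

lemma quotient_rep_compose:
  fixes b :: "'n::finite \<Rightarrow> 'e::real_vector"
  assumes L: "subspace L" and G: "linear G" and GL: "\<And>w. w \<in> L \<Longrightarrow> G w \<in> L"
    and m: "quotient_rep L b G m" and m': "quotient_rep L b G' m'"
  shows "quotient_rep L b (G \<circ> G') (m ** m')"
  unfolding quotient_rep_def
proof
  fix j
  let ?w = "G' (b j) - (\<Sum>i\<in>UNIV. m' $ i $ j *\<^sub>R b i)"
  let ?e = "\<lambda>l. G (b l) - (\<Sum>i\<in>UNIV. m $ i $ l *\<^sub>R b i)"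
  have "G ?w + (\<Sum>l\<in>UNIV. m' $ l $ j *\<^sub>R ?e l) \<in> L"
    using m m' GL by (intro subspace_add[OF L] subspace_sum[OF L] subspace_scale[OF L])
      (auto simp: quotient_rep_def)
  moreover have "G ?w = G (G' (b j)) - (\<Sum>l\<in>UNIV. m' $ l $ j *\<^sub>R G (b l))"
    using G by (simp add: linear_diff linear_sum linear_scale)
  moreover have "(\<Sum>l\<in>UNIV. m' $ l $ j *\<^sub>R ?e l) = (\<Sum>l\<in>UNIV. m' $ l $ j *\<^sub>R G (b l)) -
      (\<Sum>i\<in>UNIV. (m ** m') $ i $ j *\<^sub>R b i)"
  proof -
    have "(\<Sum>i\<in>UNIV. (m ** m') $ i $ j *\<^sub>R b i) =
        (\<Sum>i\<in>UNIV. \<Sum>l\<in>UNIV. (m' $ l $ j * m $ i $ l) *\<^sub>R b i)"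
      by (simp add: matrix_matrix_mult_def scaleR_sum_left mult.commute)
    also have "\<dots> = (\<Sum>l\<in>UNIV. \<Sum>i\<in>UNIV. (m' $ l $ j * m $ i $ l) *\<^sub>R b i)"
      by (rule sum.swap)
    also have "\<dots> = (\<Sum>l\<in>UNIV. m' $ l $ j *\<^sub>R (\<Sum>i\<in>UNIV. m $ i $ l *\<^sub>R b i))"
      by (simp add: scaleR_sum_right)
    finally show ?thesis
      by (simp add: scaleR_diff_right sum_subtractf)
  qed
  ultimately show "(G \<circ> G') (b j) - (\<Sum>i\<in>UNIV. (m ** m') $ i $ j *\<^sub>R b i) \<in> L"
    by simp
qed

lemma trace_square_2:
  fixes n :: "real^2^2"
  shows "trace (n ** n) = (trace n)\<^sup>2 - 2 * det n"
  by (simp add: trace_def det_2 matrix_matrix_mult_def sum_2 power2_eq_square algebra_simps)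

text \<open>The matrices of \<open>R\<close> and \<open>S\<close> square to the identity and thus have determinant \<open>1\<close> or \<open>- 1\<close>; the
  same holds for the matrix \<open>r ** s\<close>, whose square is \<open>a\<close>. The bound follows from the formula for the
  trace of a square.\<close>

lemma trace_square_involutions_ge:
  fixes a :: "real^2^2"
  assumes L: "subspace L" and V: "0 \<in> V" and a: "quotient_matrix V L F a"
    and R: "linear R" "\<And>w. w \<in> V \<Longrightarrow> R w \<in> V" "\<And>w. w \<in> L \<Longrightarrow> R w \<in> L" "R \<circ> R = id"
    and S: "linear S" "\<And>w. w \<in> V \<Longrightarrow> S w \<in> V" "\<And>w. w \<in> L \<Longrightarrow> S w \<in> L" "S \<circ> S = id"
    and F: "F = (R \<circ> S) \<circ> (R \<circ> S)"
  shows "trace a \<ge> - 2"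
proof -
  obtain b :: "2 \<Rightarrow> 'a" where b: "\<forall>i. b i \<in> V"
      "\<forall>w\<in>V. \<exists>!k :: real^2. w - (\<Sum>i\<in>UNIV. k $ i *\<^sub>R b i) \<in> L"
      "\<forall>j. F (b j) - (\<Sum>i\<in>UNIV. a $ i $ j *\<^sub>R b i) \<in> L"
    using a unfolding quotient_matrix_def by (elim exE conjE)
  have bV: "b i \<in> V" for i
    using b(1) ..
  have basis: "\<exists>!k :: real^2. w - (\<Sum>i\<in>UNIV. k $ i *\<^sub>R b i) \<in> L" if "w \<in> V" for w
    using b(2) that ..
  have aF: "quotient_rep L b F a"
    using b(3) unfolding quotient_rep_def .
  note unique = quotient_rep_unique[OF basis[OF V] L]
  obtain r s where r: "quotient_rep L b R r" and s: "quotient_rep L b S s"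
    using quotient_rep_exists[where V = V and b = b and L = L, OF basis bV] R(2) S(2) by metis
  have id: "quotient_rep L b id (mat 1)"
    using subspace_0[OF L] by (simp add: quotient_rep_def mat_def if_distrib if_distribR cong: if_cong)
  have "r ** r = mat 1"
    by (rule unique[OF quotient_rep_compose[OF L R(1,3) r r]]) (use id R(4) in auto)
  then have "det r * det r = 1"
    using det_mul[of r r] by simp
  moreover have "s ** s = mat 1"
    by (rule unique[OF quotient_rep_compose[OF L S(1,3) s s]]) (use id S(4) in auto)
  then have "det s * det s = 1"
    using det_mul[of s s] by simp
  ultimately have "\<bar>det (r ** s)\<bar> = 1"
    by (auto simp: det_mul square_eq_1_iff)
  moreover have RS: "quotient_rep L b (R \<circ> S) (r ** s)"
    by (rule quotient_rep_compose[OF L R(1,3) r s])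
  have "quotient_rep L b F ((r ** s) ** (r ** s))"
    unfolding F by (rule quotient_rep_compose[OF L linear_compose[OF S(1) R(1)] _ RS RS]) (simp add: R(3) S(3))
  then have "a = (r ** s) ** (r ** s)"
    by (rule unique[OF aF])
  then have "trace a = (trace (r ** s))\<^sup>2 - 2 * det (r ** s)"
    by (simp only: trace_square_2)
  ultimately show ?thesis
    using zero_le_power2[of "trace (r ** s)"] by linarith
qed

section \<open>Derivatives in charts\<close>

lemma chart_at_mem:
  assumes "smooth_atlas A"
  shows "chart_at A p \<in> A" "p \<in> fst (chart_at A p)"
proof -
  have "p \<in> (\<Union>c\<in>A. fst c)"
    using assms by (simp add: smooth_atlas_def)
  then have "\<exists>c. c \<in> A \<and> p \<in> fst c"
    by blast
  then have "chart_at A p \<in> A \<and> p \<in> fst (chart_at A p)"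
    unfolding chart_at_def by (rule someI_ex)
  then show "chart_at A p \<in> A" "p \<in> fst (chart_at A p)" by auto
qed

lemma isCont_eventually_mem:
  assumes "isCont f x" "open U" "f x \<in> U"
  shows "\<forall>\<^sub>F y in nhds x. f y \<in> U"
  using assms unfolding continuous_at_open eventually_nhds by blast

lemma has_derivative_eventually_eq:
  assumes "(f has_derivative F) (at x)" "\<forall>\<^sub>F y in nhds x. f y = g y"
  shows "(g has_derivative F) (at x)"
proof (rule has_derivative_transform_eventually[OF assms(1)])
  show "\<forall>\<^sub>F y in at x. f y = g y"
    using assms(2) unfolding eventually_at_filter by (rule eventually_mono) auto
  show "f x = g x"
    using eventually_nhds_x_imp_x[OF assms(2)] .
qed auto

lemma chart_facts:
  fixes A :: "('m::t2_space, 'e::euclidean_space) atlas"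
  assumes "smooth_atlas A" "c \<in> A"
  shows open_chart_dom: "open (fst c)" and open_chart_image: "open (snd c ` fst c)"
    and inv_chart_chart: "p \<in> fst c \<Longrightarrow> inv_chart c (snd c p) = p"
    and chart_isCont: "p \<in> fst c \<Longrightarrow> isCont (snd c) p"
    and inv_chart_isCont: "x \<in> snd c ` fst c \<Longrightarrow> isCont (inv_chart c) x"
proof -
  have c: "topological_chart c"
    using assms by (auto simp: smooth_atlas_def)
  then show o: "open (fst c)" "open (snd c ` fst c)"
    by (auto simp: topological_chart_def)
  show "inv_chart c (snd c p) = p" if "p \<in> fst c"
    using c that by (auto simp: topological_chart_def homeomorphism_def)
  show "isCont (snd c) p" if "p \<in> fst c"
    using c that o by (auto simp: topological_chart_def homeomorphism_def continuous_on_eq_continuous_at)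
  show "isCont (inv_chart c) x" if "x \<in> snd c ` fst c"
    using c that o by (auto simp: topological_chart_def homeomorphism_def continuous_on_eq_continuous_at)
qed

lemma smooth_on_differentiable:
  assumes "smooth_on S f" "x \<in> S"
  shows "f differentiable (at x)"
proof -
  have "Ck_on (Suc 0) S f"
    using assms by (simp add: smooth_on_def del: Ck_on.simps)
  then show ?thesis
    using assms by (auto simp: differentiable_def)
qed

text \<open>The one chain rule from which those for velocities, differentials and differentials of functions
  are derived: a composition factors through a point of the manifold, and \<open>c\<close> is any chart there.\<close>

lemma chain_through_chart:
  fixes A :: "('m::t2_space, 'e::euclidean_space) atlas"
  assumes A: "smooth_atlas A" "c \<in> A" and "\<beta> x0 \<in> fst c" and cont: "isCont \<beta> x0"
    and F: "((snd c \<circ> \<beta>) has_derivative F) (at x0)"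
    and G: "((K \<circ> inv_chart c) has_derivative G) (at (snd c (\<beta> x0)))"
  shows "((K \<circ> \<beta>) has_derivative G \<circ> F) (at x0)"
proof -
  have "((K \<circ> inv_chart c) \<circ> (snd c \<circ> \<beta>) has_derivative G \<circ> F) (at x0)"
    using F G by (intro diff_chain_at) auto
  moreover have "\<forall>\<^sub>F x in nhds x0. \<beta> x \<in> fst c"
    by (rule isCont_eventually_mem[OF cont open_chart_dom[OF A] assms(3)])
  then have "\<forall>\<^sub>F x in nhds x0. ((K \<circ> inv_chart c) \<circ> (snd c \<circ> \<beta>)) x = (K \<circ> \<beta>) x"
    by eventually_elim (simp add: inv_chart_chart[OF A])
  ultimately show ?thesis
    by (rule has_derivative_eventually_eq)
qed

text \<open>\<open>F\<close> is the derivative of \<open>f\<close> at \<open>p\<close> in the preferred charts at \<open>p\<close> and \<open>f p\<close>. In contrast to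
  \<open>differential\<close>, this relation asserts differentiability. Continuity at \<open>p\<close> is required separately,
  since a representation in charts says nothing about points that \<open>f\<close> maps outside the chart
  domain.\<close>

definition mfd_derivative ::
  "('m::t2_space, 'e::euclidean_space) atlas \<Rightarrow> ('m \<Rightarrow> 'm) \<Rightarrow> 'm \<Rightarrow> ('e \<Rightarrow> 'e) \<Rightarrow> bool" where
  "mfd_derivative A f p F \<longleftrightarrow> isCont f p \<and>
     ((snd (chart_at A (f p)) \<circ> f \<circ> inv_chart (chart_at A p)) has_derivative F) (at (snd (chart_at A p) p))"

lemma mfd_derivative_linear: "mfd_derivative A f p F \<Longrightarrow> linear F"
  by (auto simp: mfd_derivative_def dest: has_derivative_linear)

lemma differential_eq: "mfd_derivative A f p F \<Longrightarrow> differential A f p = F"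
  by (auto simp: mfd_derivative_def differential_def frechet_derivative_at[symmetric])

lemma mfd_derivative_unique: "mfd_derivative A f p F \<Longrightarrow> mfd_derivative A f p F' \<Longrightarrow> F = F'"
  using differential_eq by metis

lemma mfd_derivative_id:
  assumes A: "smooth_atlas A"
  shows "mfd_derivative A id p id"
proof -
  let ?c = "chart_at A p"
  note c = chart_at_mem[OF A, of p]
  have "((snd ?c \<circ> inv_chart ?c) has_derivative id) (at (snd ?c p))"
  proof (rule has_derivative_transform_within_open[OF has_derivative_id])
    show "open (snd ?c ` fst ?c)" "snd ?c p \<in> snd ?c ` fst ?c"
      using open_chart_image[OF A c(1)] c(2) by auto
  qed (auto simp: inv_chart_chart[OF A c(1)])
  then show ?thesis
    by (simp add: mfd_derivative_def id_def comp_def)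
qed

lemma mfd_derivative_cong:
  assumes A: "smooth_atlas A" and f: "mfd_derivative A f p F"
    and U: "open U" "p \<in> U" "\<And>q. q \<in> U \<Longrightarrow> f q = g q"
  shows "mfd_derivative A g p F"
proof -
  let ?c = "chart_at A p"
  note c = chart_at_mem[OF A, of p]
  have eq: "\<forall>\<^sub>F q in nhds p. f q = g q"
    using U eventually_nhds by blast
  have "isCont g p"
    using f isCont_cong[OF eq] by (simp add: mfd_derivative_def)
  moreover have "isCont (inv_chart ?c) (snd ?c p)"
    using inv_chart_isCont[OF A c(1)] c(2) by auto
  then have "\<forall>\<^sub>F x in nhds (snd ?c p). inv_chart ?c x \<in> U"
    using U inv_chart_chart[OF A c] by (intro isCont_eventually_mem) auto
  then have ev: "\<forall>\<^sub>F x in nhds (snd ?c p). (snd (chart_at A (f p)) \<circ> f \<circ> inv_chart ?c) x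
      = (snd (chart_at A (g p)) \<circ> g \<circ> inv_chart ?c) x"
    by eventually_elim (use U in auto)
  then have "((snd (chart_at A (g p)) \<circ> g \<circ> inv_chart ?c) has_derivative F) (at (snd ?c p))"
    using f has_derivative_eventually_eq unfolding mfd_derivative_def by blast
  ultimately show ?thesis
    by (simp add: mfd_derivative_def)
qed

lemma mfd_derivative_compose:
  assumes A: "smooth_atlas A" and f: "mfd_derivative A f p F" and g: "mfd_derivative A g (f p) G"
  shows "mfd_derivative A (g \<circ> f) p (G \<circ> F)"
proof -
  let ?c = "chart_at A p"
  note c = chart_at_mem[OF A, of p] and d = chart_at_mem[OF A, of "f p"]
  have p: "inv_chart ?c (snd ?c p) = p"
    using inv_chart_chart[OF A c] .
  have cont: "isCont (f \<circ> inv_chart ?c) (snd ?c p)"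
    using f p inv_chart_isCont[OF A c(1)] c(2) unfolding mfd_derivative_def
    by (intro continuous_at_compose) auto
  have "((snd (chart_at A (g (f p))) \<circ> g) \<circ> (f \<circ> inv_chart ?c) has_derivative G \<circ> F) (at (snd ?c p))"
    using f g d(2) p
    by (intro chain_through_chart[OF A d(1) _ cont]) (auto simp: mfd_derivative_def comp_assoc)
  then show ?thesis
    using f g by (auto simp: mfd_derivative_def comp_assoc continuous_at_compose)
qed

lemma smooth_map_derivative:
  assumes A: "smooth_atlas A" and f: "smooth_map A f"
  shows "mfd_derivative A f p (differential A f p)"
proof -
  let ?c = "chart_at A p" and ?d = "chart_at A (f p)"
  note c = chart_at_mem[OF A, of p] and d = chart_at_mem[OF A, of "f p"]
  have "isCont f p"
    using f by (auto simp: smooth_map_def continuous_on_eq_continuous_at)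
  moreover have "smooth_on (snd ?c ` (fst ?c \<inter> f -` fst ?d)) (snd ?d \<circ> f \<circ> inv_chart ?c)"
    using f c d by (auto simp: smooth_map_def)
  then have "(snd ?d \<circ> f \<circ> inv_chart ?c) differentiable (at (snd ?c p))"
    using c d by (intro smooth_on_differentiable) auto
  ultimately show ?thesis
    by (auto simp: mfd_derivative_def differential_def frechet_derivative_works)
qed

lemma has_velocity_map:
  assumes A: "smooth_atlas A" and \<gamma>: "has_velocity A \<gamma> t u" and f: "mfd_derivative A f (\<gamma> t) F"
  shows "has_velocity A (f \<circ> \<gamma>) t (F u)"
proof -
  note c = chart_at_mem[OF A, of "\<gamma> t"]
  have "((snd (chart_at A (f (\<gamma> t))) \<circ> f) \<circ> \<gamma> has_derivative F \<circ> (\<lambda>h. h *\<^sub>R u)) (at t)"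
    using \<gamma> f c by (intro chain_through_chart[OF A c(1)])
      (auto simp: mfd_derivative_def has_velocity_def has_vector_derivative_def)
  moreover have "F \<circ> (\<lambda>h. h *\<^sub>R u) = (\<lambda>h. h *\<^sub>R F u)"
    using mfd_derivative_linear[OF f] by (auto simp: linear_scale)
  ultimately show ?thesis
    using \<gamma> f by (auto simp: mfd_derivative_def has_velocity_def has_vector_derivative_def comp_assoc
        continuous_at_compose)
qed

lemma has_velocity_affine:
  fixes e k :: real
  assumes "has_velocity A \<gamma> (e * s + k) u"
  shows "has_velocity A (\<lambda>s. \<gamma> (e * s + k)) s (e *\<^sub>R u)"
proof -
  have "isCont (\<lambda>s. \<gamma> (e * s + k)) s"
    by (rule isCont_o2[where g = \<gamma>]) (use assms in \<open>auto simp: has_velocity_def\<close>)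
  moreover have "((snd (chart_at A (\<gamma> (e * s + k))) \<circ> \<gamma>) \<circ> (\<lambda>s. e * s + k)
      has_vector_derivative (e *\<^sub>R u)) (at s)"
    by (rule vector_diff_chain_at)
      (use assms in \<open>auto simp: has_velocity_def has_real_derivative_iff_has_vector_derivative[symmetric]
        intro!: derivative_eq_intros\<close>)
  ultimately show ?thesis
    by (simp add: has_velocity_def comp_def)
qed

lemma has_velocity_unique: "has_velocity A \<gamma> t u \<Longrightarrow> has_velocity A \<gamma> t u' \<Longrightarrow> u = u'"
  by (auto simp: has_velocity_def dest: vector_derivative_unique_at)

lemma smooth_fun_dfun:
  assumes A: "smooth_atlas A" and h: "smooth_fun A h"
  shows "((h \<circ> inv_chart (chart_at A p)) has_derivative dfun A h p) (at (snd (chart_at A p) p))"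
proof -
  note c = chart_at_mem[OF A, of p]
  have "(h \<circ> inv_chart (chart_at A p)) differentiable (at (snd (chart_at A p) p))"
    using h c unfolding smooth_fun_def by (intro smooth_on_differentiable) auto
  then show ?thesis
    by (simp add: dfun_def[abs_def] frechet_derivative_works)
qed

text \<open>Invariance of \<open>h\<close> is only required locally, because flow maps are only considered
  near a point.\<close>

lemma dfun_invariant:
  assumes A: "smooth_atlas A" and h: "smooth_fun A h" and f: "mfd_derivative A f p F"
    and inv: "\<forall>\<^sub>F q in nhds p. h (f q) = h q"
  shows "dfun A h (f p) (F u) = dfun A h p u"
proof -
  let ?c = "chart_at A p"
  note c = chart_at_mem[OF A, of p] and d = chart_at_mem[OF A, of "f p"]
  have p: "inv_chart ?c (snd ?c p) = p"
    using inv_chart_chart[OF A c] .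
  have ic: "isCont (inv_chart ?c) (snd ?c p)"
    using inv_chart_isCont[OF A c(1)] c(2) by auto
  have "(h \<circ> (f \<circ> inv_chart ?c) has_derivative dfun A h (f p) \<circ> F) (at (snd ?c p))"
  proof (rule chain_through_chart[OF A d(1)])
    show "isCont (f \<circ> inv_chart ?c) (snd ?c p)"
      using f p ic unfolding mfd_derivative_def by (intro continuous_at_compose) auto
  qed (use f d p smooth_fun_dfun[OF A h, of "f p"] in \<open>auto simp: mfd_derivative_def comp_assoc\<close>)
  moreover obtain U where U: "open U" "p \<in> U" "\<And>q. q \<in> U \<Longrightarrow> h (f q) = h q"
    using inv unfolding eventually_nhds by blast
  then have "\<forall>\<^sub>F x in nhds (snd ?c p). inv_chart ?c x \<in> U"
    using p by (intro isCont_eventually_mem[OF ic]) auto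
  then have "\<forall>\<^sub>F x in nhds (snd ?c p). (h \<circ> (f \<circ> inv_chart ?c)) x = (h \<circ> inv_chart ?c) x"
    by eventually_elim (simp add: U)
  ultimately have "(h \<circ> inv_chart ?c has_derivative dfun A h (f p) \<circ> F) (at (snd ?c p))"
    by (rule has_derivative_eventually_eq)
  then have "dfun A h (f p) \<circ> F = dfun A h p"
    by (rule has_derivative_unique[OF _ smooth_fun_dfun[OF A h]])
  then show ?thesis
    by (metis comp_apply)
qed

lemma has_velocity_fun:
  fixes A :: "('m::t2_space, 'e::euclidean_space) atlas"
  assumes A: "smooth_atlas A" and h: "smooth_fun A h" and \<gamma>: "has_velocity A \<gamma> t u"
  shows "((h \<circ> \<gamma>) has_vector_derivative dfun A h (\<gamma> t) u) (at t)"
proof -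
  note c = chart_at_mem[OF A, of "\<gamma> t"]
  have "(h \<circ> \<gamma> has_derivative dfun A h (\<gamma> t) \<circ> (\<lambda>x. x *\<^sub>R u)) (at t)"
    by (rule chain_through_chart[OF A c(1)])
      (use \<gamma> c smooth_fun_dfun[OF A h] in \<open>auto simp: has_velocity_def has_vector_derivative_def\<close>)
  moreover have "linear (dfun A h (\<gamma> t))"
    using smooth_fun_dfun[OF A h] by (rule has_derivative_linear)
  then have "dfun A h (\<gamma> t) \<circ> (\<lambda>x. x *\<^sub>R u) = (\<lambda>x. x *\<^sub>R dfun A h (\<gamma> t) u)"
    by (auto simp: linear_scale)
  ultimately show ?thesis
    by (simp add: has_vector_derivative_def)
qed

text \<open>\<open>has_velocity\<close> refers to the preferred chart at the current point of the curve, which may jump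
  along the curve. The map \<open>G\<close> converts velocities at \<open>p\<close> to the coordinates of a fixed chart \<open>c\<close>; it
  is the same for all curves through \<open>p\<close>.\<close>

lemma has_velocity_in_chart:
  fixes A :: "('m::t2_space, 'e::euclidean_space) atlas"
  assumes A: "smooth_atlas A" "c \<in> A" and p: "p \<in> fst c"
  obtains G where "\<And>\<gamma> t u. has_velocity A \<gamma> t u \<Longrightarrow> \<gamma> t = p \<Longrightarrow>
    ((snd c \<circ> \<gamma>) has_vector_derivative G u) (at t)"
proof -
  let ?d = "chart_at A p"
  note d = chart_at_mem[OF A(1), of p]
  have "smooth_on (snd ?d ` (fst ?d \<inter> fst c)) (snd c \<circ> inv_chart ?d)"
    using A d by (auto simp: smooth_atlas_def)
  then have "(snd c \<circ> inv_chart ?d) differentiable (at (snd ?d p))"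
    using p d by (intro smooth_on_differentiable) auto
  then obtain G where G: "((snd c \<circ> inv_chart ?d) has_derivative G) (at (snd ?d p))"
    unfolding differentiable_def by blast
  have "((snd c \<circ> \<gamma>) has_vector_derivative G u) (at t)" if "has_velocity A \<gamma> t u" "\<gamma> t = p" for \<gamma> t u
  proof -
    have "((snd c \<circ> \<gamma>) has_derivative G \<circ> (\<lambda>x. x *\<^sub>R u)) (at t)"
      by (rule chain_through_chart[OF A(1) d(1)])
        (use that d G in \<open>auto simp: has_velocity_def has_vector_derivative_def\<close>)
    moreover have "G \<circ> (\<lambda>x. x *\<^sub>R u) = (\<lambda>x. x *\<^sub>R G u)"
      using has_derivative_linear[OF G] by (auto simp: linear_scale)
    ultimately show ?thesis
      by (simp add: has_vector_derivative_def)
  qed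
  then show ?thesis
    using that by blast
qed

section \<open>The Hamiltonian vector field\<close>

text \<open>A covector at \<open>p\<close> is represented by a unique vector, so that the definite description in
  \<open>ham_field\<close> is meaningful.\<close>

lemma symplectic_form_representation:
  fixes A :: "('m::topological_space, 'e::euclidean_space) atlas"
  assumes \<omega>: "symplectic_form A \<omega>" and \<eta>: "linear \<eta>"
  shows "\<exists>!X. \<forall>w. \<eta> w = \<omega> p w X"
proof -
  have bil: "bilinear (\<omega> p)" and alt: "\<And>u. \<omega> p u u = 0"
    and nondeg: "\<And>u. (\<And>w. \<omega> p u w = 0) \<Longrightarrow> u = 0"
    using \<omega> unfolding symplectic_form_def two_form_def by blast+
  have lin: "linear (\<lambda>w. \<omega> p w X)" "linear (\<omega> p X)" for X
    using bil by (auto simp: bilinear_def)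
  have skew: "\<omega> p u w = - \<omega> p w u" for u w
    using alt[of "u + w"] alt[of u] alt[of w] by (simp add: bilinear_ladd[OF bil] bilinear_radd[OF bil])
  have nondeg': "X = 0" if "\<And>b. b \<in> Basis \<Longrightarrow> \<omega> p b X = 0" for X
  proof (rule nondeg)
    fix w
    have "\<omega> p w X = 0"
      using linear_eq_stdbasis[OF lin(1)[of X], of "\<lambda>w. 0"] that by (metis linear_zero)
    then show "\<omega> p X w = 0"
      using skew[of X w] by simp
  qed
  define T where "T X = (\<Sum>b\<in>Basis. \<omega> p b X *\<^sub>R b)" for X
  have inner: "T X \<bullet> b = \<omega> p b X" if "b \<in> Basis" for X b
    using that by (simp add: T_def inner_sum_left_Basis)
  have T: "linear T"
    by (rule linearI) (simp_all add: T_def bilinear_radd[OF bil] bilinear_rmul[OF bil] scaleR_add_left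
        sum.distrib scaleR_sum_right)
  moreover have "inj T"
    unfolding linear_injective_0[OF T]
  proof (intro allI impI nondeg')
    show "\<omega> p b X = 0" if "T X = 0" "b \<in> Basis" for X b
      using inner[OF that(2), of X] that(1) by simp
  qed
  ultimately have "surj T"
    by (rule linear_injective_imp_surjective) simp
  then obtain X where X: "T X = (\<Sum>b\<in>Basis. \<eta> b *\<^sub>R b)"
    by (metis surjD)
  have "\<eta> b = \<omega> p b X" if "b \<in> Basis" for b
    using inner[OF that, of X] that by (simp add: X inner_sum_left_Basis)
  then have "\<eta> = (\<lambda>w. \<omega> p w X)"
    by (rule linear_eq_stdbasis[OF \<eta> lin(1)])
  then have ex: "\<forall>w. \<eta> w = \<omega> p w X"
    by metis
  have "Y = X" if "\<forall>w. \<eta> w = \<omega> p w Y" for Y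
    using nondeg'[of "Y - X"] that ex by (simp add: bilinear_rsub[OF bil])
  with ex show ?thesis
    by blast
qed

lemma ham_field:
  assumes A: "smooth_atlas A" and \<omega>: "symplectic_form A \<omega>" and H: "smooth_fun A H"
  shows dfun_eq_ham_field: "dfun A H p w = \<omega> p w (ham_field A \<omega> H p)"
    and ham_field_eqI: "(\<And>w. dfun A H p w = \<omega> p w X) \<Longrightarrow> ham_field A \<omega> H p = X"
proof -
  have "linear (dfun A H p)"
    using smooth_fun_dfun[OF A H] by (rule has_derivative_linear)
  note ex1 = symplectic_form_representation[OF \<omega> this, of p]
  show "dfun A H p w = \<omega> p w (ham_field A \<omega> H p)"
    using theI'[OF ex1] unfolding ham_field_def by blast
  show "ham_field A \<omega> H p = X" if "\<And>w. dfun A H p w = \<omega> p w X"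
    unfolding ham_field_def using that by (intro the1_equality[OF ex1]) blast
qed

lemma antisymplectic_involution_derivative:
  fixes A :: "('m::t2_space, 'e::euclidean_space) atlas"
  assumes A: "smooth_atlas A" and \<rho>: "antisymplectic_involution A \<omega> \<rho>"
  shows "mfd_derivative A \<rho> p (differential A \<rho> p)"
    and "differential A \<rho> (\<rho> p) \<circ> differential A \<rho> p = id"
    and "\<rho> (\<rho> p) = p"
proof -
  show *: "mfd_derivative A \<rho> p (differential A \<rho> p)" for p
    using \<rho> by (auto simp: antisymplectic_involution_def diffeomorphism_def intro: smooth_map_derivative[OF A])
  have inv: "\<rho> \<circ> \<rho> = id"
    using \<rho> by (auto simp: antisymplectic_involution_def)
  then show "\<rho> (\<rho> p) = p"
    by (metis comp_apply id_apply)
  have "mfd_derivative A id p (differential A \<rho> (\<rho> p) \<circ> differential A \<rho> p)"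
    using mfd_derivative_compose[OF A * *] unfolding inv .
  then show "differential A \<rho> (\<rho> p) \<circ> differential A \<rho> p = id"
    using mfd_derivative_id[OF A] mfd_derivative_unique by blast
qed

lemma antisymplectic_involution_ham_field:
  fixes A :: "('m::t2_space, 'e::euclidean_space) atlas"
  assumes A: "smooth_atlas A" and \<omega>: "symplectic_form A \<omega>" and H: "smooth_fun A H"
    and \<rho>: "antisymplectic_involution A \<omega> \<rho>" and inv: "H \<circ> \<rho> = H"
  shows "differential A \<rho> p (ham_field A \<omega> H p) = - ham_field A \<omega> H (\<rho> p)"
proof -
  let ?X = "ham_field A \<omega> H p" and ?D = "differential A \<rho>"
  note d = antisymplectic_involution_derivative[OF A \<rho>]
  have bil: "bilinear (\<omega> q)" for q
    using \<omega> unfolding symplectic_form_def two_form_def by blast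
  \<comment> \<open>It suffices to test against the vectors \<open>w = ?D p u\<close>, because \<open>?D p\<close> is surjective.\<close>
  have "ham_field A \<omega> H (\<rho> p) = - ?D p ?X"
  proof (rule ham_field_eqI[OF A \<omega> H])
    fix w
    define u where "u = ?D (\<rho> p) w"
    have w: "?D p u = w"
      using d(2)[of "\<rho> p"] d(3)[of p] unfolding u_def by (metis comp_apply id_apply)
    have "dfun A H (\<rho> p) (?D p u) = dfun A H p u"
      by (rule dfun_invariant[OF A H d(1)]) (use inv in \<open>simp add: fun_eq_iff\<close>)
    also have "\<dots> = \<omega> p u ?X"
      by (rule dfun_eq_ham_field[OF A \<omega> H])
    also have "\<dots> = - \<omega> (\<rho> p) (?D p u) (?D p ?X)"
      using \<rho> by (simp add: antisymplectic_involution_def)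
    finally show "dfun A H (\<rho> p) w = \<omega> (\<rho> p) w (- ?D p ?X)"
      by (simp add: w bilinear_rneg[OF bil])
  qed
  then show ?thesis
    by simp
qed

lemma hamiltonian_constant_on_curve:
  fixes A :: "('m::t2_space, 'e::euclidean_space) atlas"
  assumes A: "smooth_atlas A" and \<omega>: "symplectic_form A \<omega>" and H: "smooth_fun A H"
    and J: "is_interval J" "s \<in> J" "t \<in> J"
    and \<gamma>: "\<And>t. t \<in> J \<Longrightarrow> has_velocity A \<gamma> t (ham_field A \<omega> H (\<gamma> t))"
  shows "H (\<gamma> s) = H (\<gamma> t)"
proof -
  have "((H \<circ> \<gamma>) has_vector_derivative 0) (at r within J)" if "r \<in> J" for r
  proof -
    have "\<omega> (\<gamma> r) (ham_field A \<omega> H (\<gamma> r)) (ham_field A \<omega> H (\<gamma> r)) = 0"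
      using \<omega> unfolding symplectic_form_def two_form_def by blast
    then have "((H \<circ> \<gamma>) has_vector_derivative 0) (at r)"
      using has_velocity_fun[OF A H \<gamma>[OF that]] by (simp add: dfun_eq_ham_field[OF A \<omega> H])
    then show ?thesis
      by (rule has_vector_derivative_at_within)
  qed
  then have deriv: "((H \<circ> \<gamma>) has_derivative (\<lambda>h. 0)) (at r within J)" if "r \<in> J" for r
    using that by (simp add: has_vector_derivative_def)
  have "\<exists>k. \<forall>r\<in>J. (H \<circ> \<gamma>) r = k"
    by (rule has_derivative_zero_constant[OF is_interval_convex[OF J(1)] deriv])
  then show ?thesis
    using J by auto
qed

section \<open>Integral curves and flows\<close>

lemma C1_locally_lipschitz:
  fixes Y :: "'a::euclidean_space \<Rightarrow> 'b::real_normed_vector"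
  assumes W: "open W" "x0 \<in> W" and Y: "\<And>x. x \<in> W \<Longrightarrow> (Y has_derivative Y' x) (at x)"
    and cont: "\<And>u. continuous_on W (\<lambda>x. Y' x u)"
  obtains r L where "r > 0" "L \<ge> 0" "cball x0 r \<subseteq> W"
    "\<And>x y. x \<in> cball x0 r \<Longrightarrow> y \<in> cball x0 r \<Longrightarrow> norm (Y x - Y y) \<le> L * norm (x - y)"
proof -
  obtain r where r: "r > 0" "cball x0 r \<subseteq> W"
    using W open_contains_cball by blast
  have "\<exists>B. \<forall>x\<in>cball x0 r. norm (Y' x b) \<le> B" for b
  proof -
    have "compact ((\<lambda>x. Y' x b) ` cball x0 r)"
      by (rule compact_continuous_image[OF continuous_on_subset[OF cont r(2)] compact_cball])
    then show ?thesis
      using compact_imp_bounded by (force simp: bounded_iff)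
  qed
  then obtain B where B: "\<And>b x. x \<in> cball x0 r \<Longrightarrow> norm (Y' x b) \<le> B b"
    by metis
  have B0: "B b \<ge> 0" for b
    by (rule order_trans[OF norm_ge_zero B[of x0]]) (use r(1) in simp)
  define L where "L = (\<Sum>b\<in>Basis. B b)"
  have "norm (Y x - Y y) \<le> L * norm (x - y)" if "x \<in> cball x0 r" "y \<in> cball x0 r" for x y
  proof (rule differentiable_bound[of "cball x0 r" Y Y'])
    fix z assume z: "z \<in> cball x0 r"
    then show deriv: "(Y has_derivative Y' z) (at z within cball x0 r)"
      using Y r(2) by (blast intro: has_derivative_at_withinI)
    have lin: "linear (Y' z)"
      using deriv by (rule has_derivative_linear)
    show "onorm (Y' z) \<le> L"
    proof (rule onorm_bound)
      show "0 \<le> L"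
        unfolding L_def by (rule sum_nonneg) (rule B0)
      fix u
      have "Y' z u = Y' z (\<Sum>b\<in>Basis. (u \<bullet> b) *\<^sub>R b)"
        by (simp add: euclidean_representation)
      also have "\<dots> = (\<Sum>b\<in>Basis. (u \<bullet> b) *\<^sub>R Y' z b)"
        by (simp add: linear_sum[OF lin] linear_scale[OF lin])
      also have "norm \<dots> \<le> (\<Sum>b\<in>Basis. norm u * B b)"
      proof (rule sum_norm_le)
        fix b :: 'a assume "b \<in> Basis"
        then show "norm ((u \<bullet> b) *\<^sub>R Y' z b) \<le> norm u * B b"
          unfolding norm_scaleR real_norm_def
          by (intro mult_mono Basis_le_norm B z) auto
      qed
      finally show "norm (Y' z u) \<le> L * norm u"
        by (simp add: L_def sum_distrib_left mult.commute)
    qed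
  qed (use that in auto)
  moreover have "L \<ge> 0"
    unfolding L_def by (rule sum_nonneg) (rule B0)
  ultimately show ?thesis
    using that r by blast
qed

text \<open>On a time interval of radius \<open>d\<close> with \<open>d * L \<le> 1/2\<close> the mean value inequality bounds the
  maximal distance of two solutions by half of itself.\<close>

lemma ode_unique_local:
  fixes x1 x2 :: "real \<Rightarrow> 'a::real_normed_vector"
  assumes d: "d > 0" "d * L \<le> 1/2" and L: "L \<ge> 0"
    and lip: "\<And>x y. x \<in> K \<Longrightarrow> y \<in> K \<Longrightarrow> norm (Y x - Y y) \<le> L * norm (x - y)"
    and x1: "\<And>t. t \<in> cball t0 d \<Longrightarrow> x1 t \<in> K \<and> (x1 has_vector_derivative Y (x1 t)) (at t)"
    and x2: "\<And>t. t \<in> cball t0 d \<Longrightarrow> x2 t \<in> K \<and> (x2 has_vector_derivative Y (x2 t)) (at t)"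
    and eq: "x1 t0 = x2 t0" and t: "t \<in> cball t0 d"
  shows "x1 t = x2 t"
proof -
  define w where "w t = x1 t - x2 t" for t
  have w: "(w has_vector_derivative Y (x1 t) - Y (x2 t)) (at t)" if "t \<in> cball t0 d" for t
    unfolding w_def using x1[OF that] x2[OF that] by (auto intro: has_vector_derivative_diff)
  have "continuous_on (cball t0 d) (\<lambda>t. norm (w t))"
    by (intro continuous_intros continuous_at_imp_continuous_on ballI has_vector_derivative_continuous[OF w])
  then obtain s where s: "s \<in> cball t0 d" and max: "\<And>t. t \<in> cball t0 d \<Longrightarrow> norm (w t) \<le> norm (w s)"
    using continuous_attains_sup[of "cball t0 d" "\<lambda>t. norm (w t)"] d(1) by auto
  have "norm (w s - w t0) \<le> (L * norm (w s)) * norm (s - t0)"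
  proof (rule differentiable_bound[of "cball t0 d" w "\<lambda>t h. h *\<^sub>R (Y (x1 t) - Y (x2 t))"])
    fix t assume t: "t \<in> cball t0 d"
    show "(w has_derivative (\<lambda>h. h *\<^sub>R (Y (x1 t) - Y (x2 t)))) (at t within cball t0 d)"
      using w[OF t] by (auto simp: has_vector_derivative_def intro: has_derivative_at_withinI)
    have "norm (Y (x1 t) - Y (x2 t)) \<le> L * norm (w t)"
      unfolding w_def using x1[OF t] x2[OF t] by (intro lip) auto
    also have "\<dots> \<le> L * norm (w s)"
      using max[OF t] L by (rule mult_left_mono)
    finally have "norm (h *\<^sub>R (Y (x1 t) - Y (x2 t))) \<le> L * norm (w s) * norm h" for h
      by (simp add: mult.commute mult_left_mono)
    then show "onorm (\<lambda>h. h *\<^sub>R (Y (x1 t) - Y (x2 t))) \<le> L * norm (w s)"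
      using L by (intro onorm_bound) auto
  qed (use s d in auto)
  also have "\<dots> \<le> (L * norm (w s)) * d"
    using s L by (intro mult_left_mono) (auto simp: dist_norm norm_minus_commute)
  also have "\<dots> = (d * L) * norm (w s)"
    by simp
  also have "\<dots> \<le> 1/2 * norm (w s)"
    using d(2) by (rule mult_right_mono) simp
  finally have "norm (w s) \<le> 0"
    by (simp add: w_def eq)
  then show ?thesis
    using max[OF t] norm_ge_zero[of "w t"] by (simp add: w_def)
qed

text \<open>The curve \<open>\<gamma>\<close> is only constrained at the times in \<open>J\<close>; as velocities are two-sided
  derivatives, \<open>J\<close> is meant to be open.\<close>

definition integral_curve ::
  "('m::topological_space, 'e::euclidean_space) atlas \<Rightarrow> ('m \<Rightarrow> 'e) \<Rightarrow> real set \<Rightarrow> (real \<Rightarrow> 'm) \<Rightarrow> bool" where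
  "integral_curve A X J \<gamma> \<longleftrightarrow> (\<forall>t\<in>J. has_velocity A \<gamma> t (X (\<gamma> t)))"

text \<open>The factor \<open>e\<close> is \<open>1\<close> for a symmetry of the field and \<open>- 1\<close> for a time-reversing symmetry.\<close>

lemma integral_curve_reparametrize:
  fixes A :: "('m::t2_space, 'e::euclidean_space) atlas" and e k :: real
  assumes A: "smooth_atlas A" and f: "\<And>p. mfd_derivative A f p (F p)"
    and FX: "\<And>p. F p (X p) = e *\<^sub>R X (f p)" and e: "e * e = 1"
    and \<gamma>: "integral_curve A X J \<gamma>"
  shows "integral_curve A X {s. e * s + k \<in> J} (\<lambda>s. f (\<gamma> (e * s + k)))"
  unfolding integral_curve_def
proof
  fix s assume "s \<in> {s. e * s + k \<in> J}"
  then have "has_velocity A (\<lambda>s. \<gamma> (e * s + k)) s (e *\<^sub>R X (\<gamma> (e * s + k)))"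
    using \<gamma> by (intro has_velocity_affine) (auto simp: integral_curve_def)
  from has_velocity_map[OF A this f]
  have "has_velocity A (\<lambda>s. f (\<gamma> (e * s + k))) s (F (\<gamma> (e * s + k)) (e *\<^sub>R X (\<gamma> (e * s + k))))"
    by (simp add: comp_def)
  also have "F (\<gamma> (e * s + k)) (e *\<^sub>R X (\<gamma> (e * s + k))) = (e * e) *\<^sub>R X (f (\<gamma> (e * s + k)))"
    using linear_scale[OF mfd_derivative_linear[OF f]] by (simp add: FX)
  finally show "has_velocity A (\<lambda>s. f (\<gamma> (e * s + k))) s (X (f (\<gamma> (e * s + k))))"
    by (simp add: e)
qed

lemma flow_integral_curve:
  assumes "is_flow A X D \<phi>"
  shows "integral_curve A X {t. (t, p) \<in> D} (\<lambda>t. \<phi> t p)"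
  using assms unfolding is_flow_def integral_curve_def by blast

lemma flow_domain:
  assumes "is_flow A X D \<phi>"
  shows "open D" "(0, p) \<in> D" "\<phi> 0 p = p" "is_interval {t. (t, p) \<in> D}" "open {t. (t, p) \<in> D}"
proof -
  show D: "open D" "(0, p) \<in> D" "\<phi> 0 p = p" "is_interval {t. (t, p) \<in> D}"
    using assms unfolding is_flow_def by blast+
  have "open ((\<lambda>t. (t, p)) -` D)"
    by (intro open_vimage D(1) continuous_intros)
  then show "open {t. (t, p) \<in> D}"
    by (simp add: vimage_def)
qed

text \<open>A field which has a smooth flow is continuously differentiable in every chart, being the time
  derivative of the flow at time \<open>0\<close>. This avoids deriving the smoothness of \<open>ham_field\<close> from that
  of the form.\<close>

lemma flow_field_in_chart:
  fixes A :: "('m::t2_space, 'e::euclidean_space) atlas"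
  assumes A: "smooth_atlas A" "c \<in> A" and flow: "is_flow A X D \<phi>"
  obtains Y Y' where "\<And>x. x \<in> snd c ` fst c \<Longrightarrow> (Y has_derivative Y' x) (at x)"
    "\<And>u. continuous_on (snd c ` fst c) (\<lambda>x. Y' x u)"
    "\<And>\<gamma> t. has_velocity A \<gamma> t (X (\<gamma> t)) \<Longrightarrow> \<gamma> t \<in> fst c \<Longrightarrow>
       ((snd c \<circ> \<gamma>) has_vector_derivative Y (snd c (\<gamma> t))) (at t)"
proof -
  define S where "S = {(t, x). x \<in> snd c ` fst c \<and> (t, inv_chart c x) \<in> D \<and> \<phi> t (inv_chart c x) \<in> fst c}"
  define f where "f = (\<lambda>(t, x). snd c (\<phi> t (inv_chart c x)))"
  have "smooth_on S f"
    using flow A(2) unfolding is_flow_def S_def f_def by blast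
  then have "Ck_on (Suc (Suc 0)) S f"
    unfolding smooth_on_def by blast
  then obtain f' where f': "\<And>z. z \<in> S \<Longrightarrow> (f has_derivative f' z) (at z)"
    and C1: "\<And>u. Ck_on (Suc 0) S (\<lambda>z. f' z u)"
    unfolding Ck_on.simps(2)[of "Suc 0"] by blast
  obtain g' where g': "\<And>z. z \<in> S \<Longrightarrow> ((\<lambda>z. f' z (1, 0)) has_derivative g' z) (at z)"
    and C0: "\<And>u. continuous_on S (\<lambda>z. g' z u)"
    using C1[of "(1, 0)"] unfolding Ck_on.simps by blast
  have S: "(0, x) \<in> S" if "x \<in> snd c ` fst c" for x
    using that flow_domain[OF flow] by (auto simp: S_def inv_chart_chart[OF A])
  define Y where "Y x = f' (0, x) (1, 0)" for x
  define Y' where "Y' x u = g' (0, x) (0, u)" for x u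
  show ?thesis
  proof
    fix x assume x: "x \<in> snd c ` fst c"
    have "((\<lambda>x. (0 :: real, x)) has_derivative (\<lambda>u. (0, u))) (at x)"
      by (auto intro!: derivative_eq_intros)
    from has_derivative_compose[OF this g'[OF S[OF x]]]
    show "(Y has_derivative Y' x) (at x)"
      by (simp add: Y_def[abs_def] Y'_def[abs_def])
  next
    fix u
    show "continuous_on (snd c ` fst c) (\<lambda>x. Y' x u)"
      unfolding Y'_def
      by (rule continuous_on_compose2[OF C0, of _ "\<lambda>x. (0, x)"]) (auto intro!: continuous_intros S)
  next
    fix \<gamma> t assume \<gamma>: "has_velocity A \<gamma> t (X (\<gamma> t))" and c: "\<gamma> t \<in> fst c"
    obtain G where G: "\<And>\<beta> s u. has_velocity A \<beta> s u \<Longrightarrow> \<beta> s = \<gamma> t \<Longrightarrow>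
        ((snd c \<circ> \<beta>) has_vector_derivative G u) (at s)"
      using has_velocity_in_chart[OF A c] by blast
    let ?x = "snd c (\<gamma> t)"
    have "has_velocity A (\<lambda>s. \<phi> s (\<gamma> t)) 0 (X (\<gamma> t))"
      using flow_integral_curve[OF flow, of "\<gamma> t"] flow_domain(2,3)[OF flow, of "\<gamma> t"]
      by (auto simp: integral_curve_def)
    then have "((\<lambda>s. snd c (\<phi> s (\<gamma> t))) has_vector_derivative G (X (\<gamma> t))) (at 0)"
      using G[of "\<lambda>s. \<phi> s (\<gamma> t)" 0] flow_domain(3)[OF flow, of "\<gamma> t"] by (simp add: comp_def)
    moreover have "((\<lambda>s. snd c (\<phi> s (\<gamma> t))) has_vector_derivative Y ?x) (at 0)"
    proof -
      have S0: "(0, ?x) \<in> S"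
        using S c by blast
      have "((\<lambda>s. (s, ?x)) has_derivative (\<lambda>h. (h, 0))) (at (0 :: real))"
        by (auto intro!: derivative_eq_intros)
      from has_derivative_compose[OF this f'[OF S0]]
      have "((\<lambda>s. f (s, ?x)) has_derivative (\<lambda>h. f' (0, ?x) (h, 0))) (at 0)" .
      moreover have "(\<lambda>h. f' (0, ?x) (h, 0)) = (\<lambda>h. h *\<^sub>R Y ?x)"
      proof
        fix h :: real
        have "f' (0, ?x) (h *\<^sub>R (1, 0)) = h *\<^sub>R Y ?x"
          unfolding Y_def by (rule linear_scale[OF has_derivative_linear[OF f'[OF S0]]])
        then show "f' (0, ?x) (h, 0) = h *\<^sub>R Y ?x"
          by simp
      qed
      ultimately show ?thesis
        by (simp add: f_def has_vector_derivative_def inv_chart_chart[OF A c])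
    qed
    ultimately have "G (X (\<gamma> t)) = Y ?x"
      by (rule vector_derivative_unique_at)
    then show "((snd c \<circ> \<gamma>) has_vector_derivative Y ?x) (at t)"
      using G[OF \<gamma> refl] by simp
  qed
qed

lemma integral_curve_unique_local:
  fixes A :: "('m::t2_space, 'e::euclidean_space) atlas"
  assumes A: "smooth_atlas A" and flow: "is_flow A X D \<phi>" and J: "open J" "t0 \<in> J"
    and \<gamma>: "integral_curve A X J \<gamma>1" "integral_curve A X J \<gamma>2" and eq: "\<gamma>1 t0 = \<gamma>2 t0"
  shows "\<forall>\<^sub>F t in nhds t0. \<gamma>1 t = \<gamma>2 t"
proof -
  let ?c = "chart_at A (\<gamma>1 t0)"
  note c = chart_at_mem[OF A, of "\<gamma>1 t0"]
  obtain Y Y' where Y: "\<And>x. x \<in> snd ?c ` fst ?c \<Longrightarrow> (Y has_derivative Y' x) (at x)"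
      "\<And>u. continuous_on (snd ?c ` fst ?c) (\<lambda>x. Y' x u)"
    and vel: "\<And>\<gamma> t. has_velocity A \<gamma> t (X (\<gamma> t)) \<Longrightarrow> \<gamma> t \<in> fst ?c \<Longrightarrow>
       ((snd ?c \<circ> \<gamma>) has_vector_derivative Y (snd ?c (\<gamma> t))) (at t)"
    using flow_field_in_chart[OF A c(1) flow] by blast
  let ?x0 = "snd ?c (\<gamma>1 t0)"
  obtain r L where r: "r > 0" "L \<ge> 0"
    and lip: "\<And>x y. x \<in> cball ?x0 r \<Longrightarrow> y \<in> cball ?x0 r \<Longrightarrow> norm (Y x - Y y) \<le> L * norm (x - y)"
    using C1_locally_lipschitz[OF open_chart_image[OF A c(1)] imageI[OF c(2)] Y] by metis
  have near: "\<forall>\<^sub>F t in nhds t0. t \<in> J \<and> \<gamma> t \<in> fst ?c \<and> snd ?c (\<gamma> t) \<in> ball ?x0 r"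
    if \<gamma>: "integral_curve A X J \<gamma>" and "\<gamma> t0 = \<gamma>1 t0" for \<gamma>
  proof (intro eventually_conj)
    have cont: "isCont \<gamma> t0"
      using \<gamma> J by (auto simp: integral_curve_def has_velocity_def)
    show "\<forall>\<^sub>F t in nhds t0. t \<in> J"
      using J by (rule eventually_nhds_in_open)
    show "\<forall>\<^sub>F t in nhds t0. \<gamma> t \<in> fst ?c"
      using that c by (intro isCont_eventually_mem[OF cont] open_chart_dom[OF A c(1)]) simp
    have "isCont (snd ?c \<circ> \<gamma>) t0"
      using that chart_isCont[OF A c] by (intro continuous_at_compose cont) simp
    then have "\<forall>\<^sub>F t in nhds t0. (snd ?c \<circ> \<gamma>) t \<in> ball ?x0 r"
      by (rule isCont_eventually_mem) (use that r in auto)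
    then show "\<forall>\<^sub>F t in nhds t0. snd ?c (\<gamma> t) \<in> ball ?x0 r"
      by simp
  qed
  from eventually_conj[OF near[OF \<gamma>(1) refl] near[OF \<gamma>(2) eq[symmetric]]]
  obtain T where T: "open T" "t0 \<in> T" and near: "\<And>t. t \<in> T \<Longrightarrow> t \<in> J \<and>
      \<gamma>1 t \<in> fst ?c \<and> snd ?c (\<gamma>1 t) \<in> ball ?x0 r \<and> \<gamma>2 t \<in> fst ?c \<and> snd ?c (\<gamma>2 t) \<in> ball ?x0 r"
    unfolding eventually_nhds by blast
  obtain d0 where d0: "d0 > 0" "cball t0 d0 \<subseteq> T"
    using T open_contains_cball by blast
  \<comment> \<open>The summand \<open>1\<close> guards against \<open>L = 0\<close>.\<close>
  define d where "d = min d0 (1 / (2 * (L + 1)))"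
  have d: "d > 0" "d \<le> d0"
    using d0 r by (auto simp: d_def)
  have "d * L \<le> 1 / (2 * (L + 1)) * L"
    using r(2) by (intro mult_right_mono) (auto simp: d_def)
  also have "\<dots> \<le> 1/2"
    using r(2) by (simp add: field_simps)
  finally have dL: "d * L \<le> 1/2" .
  have T': "t \<in> T" if "t \<in> cball t0 d" for t
    using that d d0 by auto
  have "\<gamma>1 t = \<gamma>2 t" if "t \<in> cball t0 d" for t
  proof -
    have "(snd ?c \<circ> \<gamma>1) t = (snd ?c \<circ> \<gamma>2) t"
    proof (rule ode_unique_local[OF d(1) dL r(2) lip])
      show "(snd ?c \<circ> \<gamma>1) s \<in> cball ?x0 r \<and>
          (snd ?c \<circ> \<gamma>1 has_vector_derivative Y ((snd ?c \<circ> \<gamma>1) s)) (at s)" if "s \<in> cball t0 d" for s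
        using near[OF T'[OF that]] vel[of \<gamma>1 s] \<gamma>(1) by (auto simp: integral_curve_def)
      show "(snd ?c \<circ> \<gamma>2) s \<in> cball ?x0 r \<and>
          (snd ?c \<circ> \<gamma>2 has_vector_derivative Y ((snd ?c \<circ> \<gamma>2) s)) (at s)" if "s \<in> cball t0 d" for s
        using near[OF T'[OF that]] vel[of \<gamma>2 s] \<gamma>(2) by (auto simp: integral_curve_def)
    qed (use eq that in auto)
    then show ?thesis
      using inv_chart_chart[OF A c(1)] near[OF T'[OF that]] by (metis comp_apply)
  qed
  moreover have "\<forall>\<^sub>F t in nhds t0. t \<in> ball t0 d"
    using d by (intro eventually_nhds_in_open) auto
  ultimately show ?thesis
    by (auto elim!: eventually_mono)
qed

lemma integral_curve_unique:
  fixes A :: "('m::t2_space, 'e::euclidean_space) atlas"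
  assumes A: "smooth_atlas A" and flow: "is_flow A X D \<phi>" and J: "open J" "is_interval J" "s \<in> J" "t \<in> J"
    and \<gamma>: "integral_curve A X J \<gamma>1" "integral_curve A X J \<gamma>2" and eq: "\<gamma>1 s = \<gamma>2 s"
  shows "\<gamma>1 t = \<gamma>2 t"
proof -
  have openI: "open {t \<in> J. P t}" if "\<And>t. t \<in> J \<Longrightarrow> P t \<Longrightarrow> \<forall>\<^sub>F s in nhds t. P s" for P
  proof (rule iffD2[OF open_subopen], rule ballI)
    fix t assume "t \<in> {t \<in> J. P t}"
    then have t: "t \<in> J" "P t"
      by auto
    then have "\<forall>\<^sub>F s in nhds t. P s"
      by (rule that)
    then obtain T where T: "open T" "t \<in> T" "\<forall>s\<in>T. P s"
      unfolding eventually_nhds by blast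
    show "\<exists>T. open T \<and> t \<in> T \<and> T \<subseteq> {t \<in> J. P t}"
      by (rule exI[of _ "T \<inter> J"]) (use T t J in auto)
  qed
  have "open {t \<in> J. \<gamma>1 t = \<gamma>2 t}"
    using integral_curve_unique_local[OF A flow J(1) _ \<gamma>] by (rule openI)
  moreover have "open {t \<in> J. \<gamma>1 t \<noteq> \<gamma>2 t}"
  proof (rule openI)
    fix t assume t: "t \<in> J" "\<gamma>1 t \<noteq> \<gamma>2 t"
    then obtain U V where UV: "open U" "open V" "\<gamma>1 t \<in> U" "\<gamma>2 t \<in> V" "U \<inter> V = {}"
      using separation_t2 by metis
    have "isCont \<gamma>1 t" "isCont \<gamma>2 t"
      using \<gamma> t by (auto simp: integral_curve_def has_velocity_def)
    then have "\<forall>\<^sub>F s in nhds t. \<gamma>1 s \<in> U \<and> \<gamma>2 s \<in> V"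
      using UV by (intro eventually_conj isCont_eventually_mem)
    then show "\<forall>\<^sub>F s in nhds t. \<gamma>1 s \<noteq> \<gamma>2 s"
      by eventually_elim (use UV(5) in auto)
  qed
  moreover have "connected J"
    using J(2) by (rule is_interval_connected)
  ultimately have "{t \<in> J. \<gamma>1 t = \<gamma>2 t} \<inter> J = {} \<or> {t \<in> J. \<gamma>1 t \<noteq> \<gamma>2 t} \<inter> J = {}"
    by (intro connectedD) auto
  then show ?thesis
    using J(3,4) eq by auto
qed

lemma flow_eq_integral_curve:
  fixes A :: "('m::t2_space, 'e::euclidean_space) atlas"
  assumes A: "smooth_atlas A" and flow: "is_flow A X D \<phi>" and J: "open J" "is_interval J" "0 \<in> J" "t \<in> J"
    and \<gamma>: "integral_curve A X J \<gamma>"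
  shows "(t, \<gamma> 0) \<in> D" "\<phi> t (\<gamma> 0) = \<gamma> t"
proof -
  have D: "(t, \<gamma> 0) \<in> D" if "t \<in> J" for t
    using flow J \<gamma> that unfolding is_flow_def integral_curve_def by blast
  then show "(t, \<gamma> 0) \<in> D"
    using J by blast
  have "integral_curve A X J (\<lambda>t. \<phi> t (\<gamma> 0))"
    using flow_integral_curve[OF flow, of "\<gamma> 0"] D by (auto simp: integral_curve_def)
  then show "\<phi> t (\<gamma> 0) = \<gamma> t"
    using integral_curve_unique[OF A flow J] \<gamma> flow_domain(3)[OF flow] by blast
qed

lemma flow_derivative:
  fixes A :: "('m::t2_space, 'e::euclidean_space) atlas"
  assumes A: "smooth_atlas A" and flow: "is_flow A X D \<phi>" and D: "(t, p) \<in> D"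
  shows "mfd_derivative A (\<phi> t) p (differential A (\<phi> t) p)"
proof -
  let ?c = "chart_at A p" and ?d = "chart_at A (\<phi> t p)"
  note c = chart_at_mem[OF A, of p] and d = chart_at_mem[OF A, of "\<phi> t p"]
  have "isCont (\<phi> t) p"
  proof -
    have "continuous_on D (\<lambda>(t, p). \<phi> t p)"
      using flow unfolding is_flow_def by blast
    then have "isCont (\<lambda>(t, p). \<phi> t p) (t, p)"
      using continuous_on_eq_continuous_at[OF flow_domain(1)[OF flow]] D by blast
    then have "isCont (\<lambda>q. (\<lambda>(t, p). \<phi> t p) (t, q)) p"
      by (rule isCont_o2[rotated]) (intro continuous_intros)
    then show ?thesis
      by simp
  qed
  moreover have "(snd ?d \<circ> \<phi> t \<circ> inv_chart ?c) differentiable (at (snd ?c p))"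
  proof -
    let ?S = "{(t, x). x \<in> snd ?c ` fst ?c \<and> (t, inv_chart ?c x) \<in> D \<and> \<phi> t (inv_chart ?c x) \<in> fst ?d}"
    let ?f = "\<lambda>(t, x). snd ?d (\<phi> t (inv_chart ?c x))"
    have "smooth_on ?S ?f"
      using flow c(1) d(1) unfolding is_flow_def by blast
    moreover have "(t, snd ?c p) \<in> ?S"
      using c d D by (auto simp: inv_chart_chart[OF A c])
    ultimately have "?f differentiable (at (t, snd ?c p))"
      by (rule smooth_on_differentiable)
    moreover have "(\<lambda>x. (t, x)) differentiable (at (snd ?c p))"
      by (intro derivative_intros)
    ultimately have "(?f \<circ> (\<lambda>x. (t, x))) differentiable (at (snd ?c p))"
      by (intro differentiable_chain_at)
    then show ?thesis
      by (simp add: comp_def)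
  qed
  ultimately show ?thesis
    by (auto simp: mfd_derivative_def differential_def frechet_derivative_works)
qed

section \<open>Doubly symmetric periodic orbits\<close>

text \<open>If \<open>\<rho>\<close> reverses the Hamiltonian field, then it conjugates the flow to the flow in backward time:
  \<open>s \<mapsto> \<rho> (\<phi> (h - s) p)\<close> is the integral curve starting at \<open>\<rho> (\<phi> h p)\<close>. The field may be
  incomplete, so membership in the flow domain is part of the claim.\<close>

lemma antisymplectic_involution_reverses_flow:
  fixes A :: "('m::t2_space, 'e::euclidean_space) atlas" and h t :: real
  assumes A: "smooth_atlas A" and \<omega>: "symplectic_form A \<omega>" and H: "smooth_fun A H"
    and \<rho>: "antisymplectic_involution A \<omega> \<rho>" "H \<circ> \<rho> = H"
    and flow: "is_flow A (ham_field A \<omega> H) D \<phi>"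
    and D: "(h, p) \<in> D" "(h - t, p) \<in> D"
  shows "(t, \<rho> (\<phi> h p)) \<in> D" "\<phi> t (\<rho> (\<phi> h p)) = \<rho> (\<phi> (h - t) p)"
proof -
  let ?I = "{s. (s, p) \<in> D}"
  let ?J = "{s. (-1) * s + h \<in> ?I}" and ?\<gamma> = "\<lambda>s. \<rho> (\<phi> ((-1) * s + h) p)"
  have \<gamma>: "integral_curve A (ham_field A \<omega> H) ?J ?\<gamma>"
    using antisymplectic_involution_ham_field[OF A \<omega> H \<rho>]
    by (intro integral_curve_reparametrize[OF A antisymplectic_involution_derivative(1)[OF A \<rho>(1)]]
        flow_integral_curve[OF flow]) auto
  have "open ((\<lambda>s. (-1) * s + h) -` ?I)"
    by (intro open_vimage flow_domain(5)[OF flow] continuous_intros)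
  then have J: "open ?J"
    by (simp add: vimage_def)
  have "is_interval ?J"
    unfolding is_interval_1
  proof (intro ballI allI impI)
    fix a b x assume "a \<in> ?J" "b \<in> ?J" "a \<le> x \<and> x \<le> b"
    then have "(-1) * b + h \<in> ?I" "(-1) * a + h \<in> ?I" "(-1) * b + h \<le> (-1) * x + h \<and> (-1) * x + h \<le> (-1) * a + h"
      by auto
    then have "(-1) * x + h \<in> ?I"
      using flow_domain(4)[OF flow, of p] unfolding is_interval_1 by blast
    then show "x \<in> ?J"
      by simp
  qed
  moreover have "0 \<in> ?J" "t \<in> ?J"
    using D by auto
  ultimately show "(t, \<rho> (\<phi> h p)) \<in> D" "\<phi> t (\<rho> (\<phi> h p)) = \<rho> (\<phi> (h - t) p)"
    using flow_eq_integral_curve[OF A flow J _ _ _ \<gamma>, of t] by auto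
qed

text \<open>The time parameter of a periodic orbit is scaled by its period.\<close>

lemma flow_periodic_orbit:
  fixes A :: "('m::t2_space, 'e::euclidean_space) atlas"
  assumes A: "smooth_atlas A" and flow: "is_flow A X D \<phi>" and v: "periodic_orbit A X v \<tau>"
  shows "(t, v s) \<in> D" "\<phi> t (v s) = v (s + t / \<tau>)"
proof -
  have \<tau>: "\<tau> > 0" and vel: "\<And>t. has_velocity A v t (\<tau> *\<^sub>R X (v t))"
    using v by (auto simp: periodic_orbit_def)
  have "integral_curve A X UNIV (\<lambda>t. v (1 / \<tau> * t + s))"
    unfolding integral_curve_def
  proof
    fix t
    show "has_velocity A (\<lambda>t. v (1 / \<tau> * t + s)) t (X (v (1 / \<tau> * t + s)))"
      using has_velocity_affine[where e = "1 / \<tau>" and s = t and k = s, OF vel] \<tau> by simp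
  qed
  from flow_eq_integral_curve[OF A flow open_UNIV is_interval_univ UNIV_I UNIV_I this, of t]
  show "(t, v s) \<in> D" "\<phi> t (v s) = v (s + t / \<tau>)"
    by (simp_all add: add.commute)
qed

text \<open>The heart of the matter: a doubly symmetric orbit is never negative hyperbolic. With
  \<open>h = \<tau> / 2\<close>, the map \<open>\<psi> = \<rho>2 \<circ> \<phi> h\<close> fixes \<open>v 0\<close>, and both \<open>\<psi> \<circ> \<psi> = id\<close> and
  \<open>(\<rho>1 \<circ> \<psi>) \<circ> (\<rho>1 \<circ> \<psi>) = \<phi> \<tau>\<close> hold near \<open>v 0\<close>.\<close>

lemma trace_doubly_symmetric_ge:
  fixes A :: "('m::t2_space, 'e::euclidean_space) atlas"
  assumes A: "smooth_atlas A" and \<omega>: "symplectic_form A \<omega>" and H: "smooth_fun A H"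
    and \<rho>1: "antisymplectic_involution A \<omega> \<rho>1" and \<rho>2: "antisymplectic_involution A \<omega> \<rho>2"
    and comm: "\<rho>1 \<circ> \<rho>2 = \<rho>2 \<circ> \<rho>1" and H\<rho>1: "H \<circ> \<rho>1 = H" and H\<rho>2: "H \<circ> \<rho>2 = H"
    and v: "doubly_symmetric_orbit A (ham_field A \<omega> H) \<rho>1 \<rho>2 v"
    and a: "reduced_monodromy A \<omega> H v a"
  shows "trace a \<ge> - 2"
proof -
  let ?X = "ham_field A \<omega> H" and ?p = "v 0"
  obtain \<tau> D \<phi> where per: "periodic_orbit A ?X v \<tau>" and flow: "is_flow A ?X D \<phi>"
    and quot: "quotient_matrix {w. dfun A H ?p w = 0} (span {?X ?p}) (differential A (\<phi> \<tau>) ?p) a"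
    using a unfolding reduced_monodromy_def by blast
  note along = flow_periodic_orbit[OF A flow per]
  note inv1 = antisymplectic_involution_derivative[OF A \<rho>1]
    and inv2 = antisymplectic_involution_derivative[OF A \<rho>2]
  note rev1 = antisymplectic_involution_reverses_flow[OF A \<omega> H \<rho>1 H\<rho>1 flow]
    and rev2 = antisymplectic_involution_reverses_flow[OF A \<omega> H \<rho>2 H\<rho>2 flow]
  have \<tau>: "\<tau> > 0" and vel: "\<And>t. has_velocity A v t (\<tau> *\<^sub>R ?X (v t))"
    using per by (auto simp: periodic_orbit_def)
  define h where "h = \<tau> / 2"
  have h: "h / \<tau> = 1/2" "h + h = \<tau>"
    using \<tau> by (auto simp: h_def)
  have fix1: "\<rho>1 ?p = ?p"
    using v unfolding doubly_symmetric_orbit_def symmetric_orbit_def by (metis minus_zero)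
  have swap2: "\<rho>2 (v (1/2)) = ?p"
    using v inv2(3)[of ?p] by (simp add: doubly_symmetric_orbit_def)
  have half: "\<phi> h ?p = v (1/2)"
    using along(2)[of h 0] h by simp
  define \<psi> where "\<psi> = \<rho>2 \<circ> \<phi> h"
  have fix\<psi>: "\<psi> ?p = ?p"
    by (simp add: \<psi>_def half swap2)
  define U where "U = {p. (h, p) \<in> D \<and> (\<tau>, p) \<in> D}"
  have U: "open U" "?p \<in> U"
  proof -
    have "open ((\<lambda>p. (h, p)) -` D \<inter> (\<lambda>p. (\<tau>, p)) -` D)"
      by (intro open_Int open_vimage flow_domain(1)[OF flow] continuous_intros)
    then show "open U"
      by (simp add: U_def vimage_def Collect_conj_eq)
    show "?p \<in> U"
      by (simp add: U_def along(1))
  qed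
  have \<psi>\<psi>: "(\<psi> \<circ> \<psi>) q = q" if "q \<in> U" for q
    using rev2(2)[of h q h] that flow_domain(2,3)[OF flow, of q] by (simp add: U_def \<psi>_def inv2(3))
  have square: "((\<rho>1 \<circ> \<psi>) \<circ> (\<rho>1 \<circ> \<psi>)) q = \<phi> \<tau> q" if "q \<in> U" for q
  proof -
    let ?q = "\<psi> q"
    have "(h, q) \<in> D" "(h - - h, q) \<in> D"
      using that h(2) by (auto simp: U_def)
    \<comment> \<open>Reversal by \<open>\<rho>2\<close> with \<open>t = - h\<close>; the domain condition concerns \<open>h - t = \<tau>\<close>.\<close>
    from rev2[OF this] have q: "(- h, ?q) \<in> D" "\<phi> (- h) ?q = \<rho>2 (\<phi> \<tau> q)"
      using h(2) by (simp_all add: \<psi>_def)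
    have "\<phi> h (\<rho>1 (\<phi> 0 ?q)) = \<rho>1 (\<phi> (0 - h) ?q)"
      by (rule rev1(2)) (use q flow_domain(2)[OF flow] in auto)
    then have "\<phi> h (\<rho>1 ?q) = \<rho>1 (\<rho>2 (\<phi> \<tau> q))"
      using q(2) flow_domain(3)[OF flow] by simp
    then have "((\<rho>1 \<circ> \<psi>) \<circ> (\<rho>1 \<circ> \<psi>)) q = \<rho>1 ((\<rho>2 \<circ> \<rho>1) (\<rho>2 (\<phi> \<tau> q)))"
      by (simp add: \<psi>_def)
    also have "\<dots> = \<phi> \<tau> q"
      unfolding comm[symmetric] by (simp add: inv1(3) inv2(3))
    finally show ?thesis .
  qed
  let ?R = "differential A \<rho>1 ?p"
  define S where "S = differential A \<rho>2 (v (1/2)) \<circ> differential A (\<phi> h) ?p"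
  have d\<phi>: "mfd_derivative A (\<phi> h) ?p (differential A (\<phi> h) ?p)"
    by (rule flow_derivative[OF A flow along(1)])
  have S: "mfd_derivative A \<psi> ?p S"
    unfolding \<psi>_def S_def
    by (rule mfd_derivative_compose[OF A d\<phi>]) (simp add: half inv2(1))
  have "mfd_derivative A (\<psi> \<circ> \<psi>) ?p (S \<circ> S)"
    by (rule mfd_derivative_compose[OF A S]) (simp add: fix\<psi> S)
  then have "mfd_derivative A id ?p (S \<circ> S)"
    by (rule mfd_derivative_cong[OF A _ U]) (simp only: \<psi>\<psi> id_apply)
  then have SS: "S \<circ> S = id"
    using mfd_derivative_id[OF A] mfd_derivative_unique by blast
  have RR: "?R \<circ> ?R = id"
    using inv1(2)[of ?p] by (simp add: fix1)
  have RS: "mfd_derivative A (\<rho>1 \<circ> \<psi>) ?p (?R \<circ> S)"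
    by (rule mfd_derivative_compose[OF A S]) (simp add: fix\<psi> inv1(1))
  have "mfd_derivative A ((\<rho>1 \<circ> \<psi>) \<circ> (\<rho>1 \<circ> \<psi>)) ?p ((?R \<circ> S) \<circ> (?R \<circ> S))"
    by (rule mfd_derivative_compose[OF A RS]) (use RS in \<open>simp add: fix\<psi> fix1\<close>)
  then have "mfd_derivative A (\<phi> \<tau>) ?p ((?R \<circ> S) \<circ> (?R \<circ> S))"
    by (rule mfd_derivative_cong[OF A _ U square])
  then have F: "differential A (\<phi> \<tau>) ?p = (?R \<circ> S) \<circ> (?R \<circ> S)"
    by (rule differential_eq)
  have RX: "?R (?X ?p) = - ?X ?p"
    using antisymplectic_involution_ham_field[OF A \<omega> H \<rho>1 H\<rho>1, of ?p] by (simp add: fix1)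
  \<comment> \<open>The differential of \<open>\<phi> h\<close> transports the velocity of \<open>v\<close> from time \<open>0\<close> to time \<open>1/2\<close>,
    and \<open>\<rho>2\<close> maps it back with the opposite sign.\<close>
  have SX: "S (?X ?p) = - ?X ?p"
  proof -
    have "has_velocity A (\<phi> h \<circ> v) 0 (differential A (\<phi> h) ?p (\<tau> *\<^sub>R ?X ?p))"
      by (rule has_velocity_map[OF A vel d\<phi>])
    moreover have "has_velocity A (\<phi> h \<circ> v) 0 (\<tau> *\<^sub>R ?X (v (1/2)))"
      using has_velocity_affine[where e = 1 and s = 0 and k = "1/2", OF vel] by (simp add: along(2) h(1) comp_def)
    ultimately have "\<tau> *\<^sub>R differential A (\<phi> h) ?p (?X ?p) = \<tau> *\<^sub>R ?X (v (1/2))"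
      using has_velocity_unique linear_scale[OF mfd_derivative_linear[OF d\<phi>]] by metis
    then show ?thesis
      using \<tau> antisymplectic_involution_ham_field[OF A \<omega> H \<rho>2 H\<rho>2, of "v (1/2)"]
      by (simp add: S_def swap2)
  qed
  have H\<psi>: "\<forall>\<^sub>F q in nhds ?p. H (\<psi> q) = H q"
  proof -
    have "H (\<psi> q) = H q" if "q \<in> U" for q
    proof -
      have "H (\<phi> h q) = H (\<phi> 0 q)"
        using flow_integral_curve[OF flow, of q] that flow_domain(2,4)[OF flow, of q]
        by (intro hamiltonian_constant_on_curve[OF A \<omega> H, of "{t. (t, q) \<in> D}"])
          (auto simp: integral_curve_def U_def)
      then show ?thesis
        using fun_cong[OF H\<rho>2, of "\<phi> h q"] flow_domain(3)[OF flow] by (simp add: \<psi>_def)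
    qed
    then show ?thesis
      using U unfolding eventually_nhds by blast
  qed
  show ?thesis
  proof (rule trace_square_involutions_ge[OF subspace_span _ quot _ _ _ RR _ _ _ SS F])
    show "0 \<in> {w. dfun A H ?p w = 0}"
      using linear_0[OF has_derivative_linear[OF smooth_fun_dfun[OF A H, of ?p]]] by simp
    show lin: "linear ?R" "linear S"
      using inv1(1) S by (auto intro: mfd_derivative_linear)
    show "?R w \<in> {w. dfun A H ?p w = 0}" if "w \<in> {w. dfun A H ?p w = 0}" for w
      using dfun_invariant[OF A H inv1(1), of ?p w] that H\<rho>1 by (simp add: fix1 fun_eq_iff)
    show "S w \<in> {w. dfun A H ?p w = 0}" if "w \<in> {w. dfun A H ?p w = 0}" for w
      using dfun_invariant[OF A H S H\<psi>, of w] that by (simp add: fix\<psi>)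
    show "?R w \<in> span {?X ?p}" if "w \<in> span {?X ?p}" for w
      using that by (auto simp: span_singleton linear_scale[OF lin(1)] RX intro: range_eqI[of _ _ "- _"])
    show "S w \<in> span {?X ?p}" if "w \<in> span {?X ?p}" for w
      using that by (auto simp: span_singleton linear_scale[OF lin(2)] SX intro: range_eqI[of _ _ "- _"])
  qed
qed

theorem corollaryE:
  fixes A :: "('m::{t2_space,second_countable_topology}, real^4) atlas"
    and \<omega> :: "'m \<Rightarrow> real^4 \<Rightarrow> real^4 \<Rightarrow> real"
    and \<rho>1 \<rho>2 :: "'m \<Rightarrow> 'm"
    and H :: "'m \<Rightarrow> real"
    and C :: "(real \<Rightarrow> 'm) set"
  assumes "smooth_atlas A"
    and "symplectic_form A \<omega>"
    and "antisymplectic_involution A \<omega> \<rho>1"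
    and "antisymplectic_involution A \<omega> \<rho>2"
    and "\<rho>1 \<noteq> \<rho>2"
    and "\<rho>1 \<circ> \<rho>2 = \<rho>2 \<circ> \<rho>1"
    and "smooth_fun A H"
    and "H \<circ> \<rho>1 = H"
    and "H \<circ> \<rho>2 = H"
    and "finite C"
    and "\<And>v. v \<in> C \<Longrightarrow> doubly_symmetric_orbit A (ham_field A \<omega> H) \<rho>1 \<rho>2 v"
    and "chi_SFT A \<omega> H C < 0"
  shows "\<exists>v\<in>C. stable_orbit A \<omega> H v"
proof (rule ccontr)
  assume no_elliptic: "\<not> (\<exists>v\<in>C. stable_orbit A \<omega> H v)"
  have "\<not> negative_hyperbolic A \<omega> H v" if "v \<in> C" for v
  proof
    assume "negative_hyperbolic A \<omega> H v"
    then obtain a where "reduced_monodromy A \<omega> H v a" "trace a < - 2"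
      by (auto simp: negative_hyperbolic_def)
    with trace_doubly_symmetric_ge[OF assms(1,2,7,3,4,6,8,9) assms(11)[OF that]] show False
      by fastforce
  qed
  with no_elliptic have "{v \<in> C. elliptic A \<omega> H v \<or> negative_hyperbolic A \<omega> H v} = {}"
    by blast
  then have "chi_SFT A \<omega> H C \<ge> 0"
    by (simp only: chi_SFT_def card.empty)
  with assms(12) show False
    by simp
qed

end
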